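(* Let $\nu<0$ and $0<b<a$. Then, for any $\varepsilon\in\left(0,\frac{|\nu|}{1+|\nu|}\right)$, as $t\to\infty$, $$\mathbb{P}_a^{(\nu)}(\tau_b>t)=a^{2|\nu|}\left\{1-\left(\frac{b}{a}\right)^{2|\nu|}\right\}\frac{1}{\Gamma(1+|\nu|)(2t)^{|\nu|}}+O(t^{-|\nu|-\varepsilon}),$$ where $\Gamma$ denotes the usual Gamma function.
   Context: For $\nu\in\mathbb{R}$ and $a>0$, $\mathbb{P}_a^{(\nu)}$ denotes the probability law on the path space $W=C([0,\infty);\mathbb{R})$ of a Bessel process with index $\nu$ (equivalently, of dimension $\delta=2(\nu+1)$) starting from $a$, i.e. the diffusion on the positive half-line with generator $\frac12\frac{d^2}{dx^2}+\frac{2\nu+1}{2x}\frac{d}{dx}$. For $w\in W$ and $b>0$, the first hitting time of $b$ is $\tau_b=\tau_b(w)=\inf\{t>0: w(t)=b\}$, with $\inf\emptyset=\infty$. Since $0<b<a$, a path starting from $a$ must hit $b$ before it can reach $0$, so the behaviour of the process at $0$ is irrelevant for the law of $\tau_b$. In the asymptotic statement $\nu,a,b,\varepsilon$ are fixed and the implied constant does not depend on $t$. *)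

theory Defs
  imports
    "HOL-Probability.Probability"
    "HOL-Library.Landau_Symbols"
begin

(* Elements of the path space W = C([0,\<infinity>); R) are represented by functions on real that
   are extensional on {0..} (i.e. undefined on negative times) and continuous there; W carries
   the sigma-algebra generated by the coordinate maps. *)

definition path_space :: "(real \<Rightarrow> real) measure" where
  "path_space =
     restrict_space (PiM {0..} (\<lambda>_. borel)) {w. continuous_on {0..} w}"

definition path_filtration :: "real \<Rightarrow> (real \<Rightarrow> real) measure" where
  "path_filtration t =
     vimage_algebra (space path_space) (\<lambda>w. restrict w {0..t}) (PiM {0..t} (\<lambda>_. borel))"

definition path_martingale ::
    "(real \<Rightarrow> real) measure \<Rightarrow> (real \<Rightarrow> (real \<Rightarrow> real) \<Rightarrow> real) \<Rightarrow> bool" where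
  "path_martingale P M \<longleftrightarrow>
     (\<forall>t\<ge>0. M t \<in> borel_measurable (path_filtration t) \<and> integrable P (M t)) \<and>
     (\<forall>s t. 0 \<le> s \<longrightarrow> s \<le> t \<longrightarrow>
        (AE w in P. real_cond_exp P (path_filtration s) (M t) w = M s w))"

definition C2_compact_pos :: "(real \<Rightarrow> real) set" where
  "C2_compact_pos =
     {f. (\<forall>x. f differentiable (at x)) \<and> (\<forall>x. deriv f differentiable (at x)) \<and>
         continuous_on UNIV (deriv (deriv f)) \<and>
         compact (closure {x. f x \<noteq> 0}) \<and> closure {x. f x \<noteq> 0} \<subseteq> {0<..}}"

definition bessel_generator :: "real \<Rightarrow> (real \<Rightarrow> real) \<Rightarrow> real \<Rightarrow> real" where
  "bessel_generator \<nu> f x =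
     1/2 * deriv (deriv f) x + (2 * \<nu> + 1) / (2 * x) * deriv f x"

(* "P is the law of a diffusion on the positive half-line with generator bessel_generator \<nu>,
   started at a", in the sense of the Stroock-Varadhan martingale problem.  The test functions
   are supported away from 0, so the law is determined up to the first hitting time of 0, while
   any boundary behaviour at 0 (absorption, or reflection when it is possible) is allowed.
   Since f vanishes near 0, the integrand is continuous in s even if the path visits 0. *)

definition bessel_law :: "real \<Rightarrow> real \<Rightarrow> (real \<Rightarrow> real) measure \<Rightarrow> bool" where
  "bessel_law \<nu> a P \<longleftrightarrow>
     prob_space P \<and> sets P = sets path_space \<and>
     (AE w in P. w 0 = a) \<and>
     (AE w in P. \<forall>t\<ge>0. 0 \<le> w t) \<and>
     (\<forall>f\<in>C2_compact_pos.
        path_martingale P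
          (\<lambda>t w. f (w t) - (LBINT s:{0..t}. bessel_generator \<nu> f (w s))))"

definition hitting_time :: "real \<Rightarrow> (real \<Rightarrow> real) \<Rightarrow> ereal" where
  "hitting_time b w = Inf {ereal t | t. 0 < t \<and> w t = b}"

lemma subalgebra_path_filtration:
  assumes "sets P = sets path_space"
  shows "subalgebra P (path_filtration t)"
proof -
  have sp: "space P = space path_space"
    using assms by (rule sets_eq_imp_space_eq)
  have "(\<lambda>w. restrict w {0..t}) \<in> measurable (PiM {0..} (\<lambda>_. borel :: real measure)) (PiM {0..t} (\<lambda>_. borel))"
    by (rule measurable_restrict_subset) auto
  hence m: "(\<lambda>w. restrict w {0..t}) \<in> measurable path_space (PiM {0..t} (\<lambda>_. borel :: real measure))"
    unfolding path_space_def by (rule measurable_restrict_space1)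
  hence "sets (path_filtration t) \<subseteq> sets path_space"
    unfolding path_filtration_def
    by (subst sets_vimage_algebra2) (auto intro: measurable_sets dest: measurable_space)
  thus ?thesis
    by (simp add: subalgebra_def sp assms path_filtration_def)
qed

lemma hitting_time_greater_iff:
  assumes w: "continuous_on {0..} w" and t: "0 < t"
  shows "hitting_time b w > ereal t \<longleftrightarrow> (\<forall>s\<in>{0<..t}. w s \<noteq> b)"
proof
  assume *: "hitting_time b w > ereal t"
  show "\<forall>s\<in>{0<..t}. w s \<noteq> b"
  proof (intro ballI notI)
    fix s assume "s \<in> {0<..t}" "w s = b"
    hence "hitting_time b w \<le> ereal s"
      unfolding hitting_time_def by (intro Inf_lower) auto
    with * \<open>s \<in> {0<..t}\<close> show False
      by (metis ereal_less_eq(3) greaterThanAtMost_iff leD order.trans)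
  qed
next
  assume *: "\<forall>s\<in>{0<..t}. w s \<noteq> b"
  have "isCont w t"
    using continuous_on_interior[OF w] t by (simp add: interior_real_atLeast)
  moreover have "w t \<noteq> b" using * t by auto
  ultimately have "eventually (\<lambda>s. w s \<noteq> b) (at t)"
    by (simp add: isCont_def tendsto_imp_eventually_ne)
  then obtain d where d: "d > 0" "\<And>s. s \<noteq> t \<Longrightarrow> dist s t < d \<Longrightarrow> w s \<noteq> b"
    by (auto simp: eventually_at)
  have "ereal (t + d) \<le> hitting_time b w"
    unfolding hitting_time_def
  proof (intro Inf_greatest, clarify)
    fix s assume s: "0 < s" "b = w s"
    hence "\<not> s \<le> t" using * by auto
    moreover have "\<not> dist s t < d" using s d(2)[of s] \<open>\<not> s \<le> t\<close> by auto
    ultimately show "ereal (t + d) \<le> ereal s" by (simp add: dist_real_def)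
  qed
  thus "hitting_time b w > ereal t"
    using d(1) by (metis ereal_less(2) less_add_same_cancel1 less_ereal.simps(1) order.strict_trans2)
qed

end

theory Submission
  imports Defs
begin

text \<open>
  Write \<open>\<mu> = \<bar>\<nu>\<bar>\<close> and \<open>q(t) = P(\<tau>\<^sub>b > t)\<close>, and let \<open>H\<close> be the distribution function of the Gamma law with
  parameter \<open>\<mu>\<close>. Then \<open>u(x, t) = H(x\<^sup>2 / 2t)\<close>, which is the probability of not reaching \<open>0\<close> before \<open>t\<close>,
  solves \<open>u\<^sub>t = L u\<close>, and everything follows from Dynkin's formula for explicit functions.

  Upper bound: \<open>u(x, T - r) - u(b, T)\<close> stopped at \<open>\<tau>\<^sub>b\<close> gives \<open>q(T) + (1 - q(T)) u(b, T) \<le> u(a, T)\<close>.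

  Lower bound: \<open>v(x, r) = u(x, T + s - r) (1 - (b/x)\<^bsup>2\<mu>\<^esup>)\<close> vanishes at \<open>b\<close> and is at most \<open>1\<close>; it fails to
  solve the backward equation only by \<open>O((T + s - r)\<^bsup>-\<mu>-1\<^esup>)\<close>. Integrating this defect up to \<open>\<tau>\<^sub>b\<close> costs
  \<open>s T\<^bsup>-\<mu>-1\<^esup> + q(s) T\<^bsup>-\<mu>\<^esup> + q(T/2) s\<^bsup>-\<mu>\<^esup>\<close>, and the crude bound \<open>q(t) = O(t\<^bsup>-\<mu>\<^esup>)\<close> together with
  \<open>s = T\<^bsup>1/(1+\<mu>)\<^esup>\<close> makes all of this \<open>O(T\<^bsup>-\<mu>-\<mu>/(1+\<mu>)\<^esup>)\<close>.

  Dynkin's formula is obtained from the martingale problem by freezing the time argument on a grid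
  and stopping at the first grid time by which the path has left the interval, so that no optional
  stopping theorem in continuous time is needed.
\<close>

subsection \<open>A twice differentiable cutoff\<close>

text \<open>The time to reach 0 from \<open>x\<close> is distributed as \<open>x\<^sup>2\<close>
  divided by twice a Gamma variable with parameter \<mu>; this is the origin of \<open>u\<close>.
  For large \<open>t\<close>, \<open>u(x, t)\<close> is close to \<open>x powr (2 * \<mu>) / (Gamma
  (1 + \<mu>) * (2 * t) powr \<mu>)\<close>, and \<open>x powr (2 * \<mu>)\<close> is harmonic for
  the generator. So \<open>v\<close> is to leading order a multiple of
  \<open>x powr (2 * \<mu>) - b powr (2 * \<mu>)\<close>, the harmonic function vanishing at
  \<open>b\<close>; this explains both the constant in the theorem and the smallness of the defect.
  The obstacle is that the law is known only through time-independent test functions with compact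
  support in x > 0. This forces an upper barrier \<open>N\<close> besides \<open>b\<close>, and a
  clock \<open>T + s - r\<close> that never reaches the time 0 where \<open>u\<close> is singular.
  The barrier goes to infinity by boundedness of a continuous path on \<open>{0..T}\<close>. After
  that, \<open>s\<close> tends to 0 in the upper bound but remains a free parameter in the lower
  bound.\<close>

lemma has_real_derivative_pos_part_power:
  "((\<lambda>y::real. max 0 y ^ Suc (Suc n)) has_real_derivative (real (n + 2) * max 0 y ^ Suc n)) (at y)"
proof -
  consider "y < 0" | "y > 0" | "y = 0" by linarith
  thus ?thesis
  proof cases
    case 1
    have "((\<lambda>y::real. 0) has_real_derivative 0) (at y)" by simp
    hence "((\<lambda>y::real. max 0 y ^ Suc (Suc n)) has_real_derivative 0) (at y)"
      by (rule has_field_derivative_transform_within_open[where S = "{..<0}"]) (use 1 in auto)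
    thus ?thesis using 1 by simp
  next
    case 2
    have "((\<lambda>y::real. y ^ Suc (Suc n)) has_real_derivative (real (n + 2) * y ^ Suc n)) (at y)"
      by (rule DERIV_cong[OF DERIV_pow]) simp
    hence "((\<lambda>y::real. max 0 y ^ Suc (Suc n)) has_real_derivative (real (n + 2) * y ^ Suc n)) (at y)"
      by (rule has_field_derivative_transform_within_open[where S = "{0<..}"]) (use 2 in auto)
    thus ?thesis using 2 by simp
  next
    case 3
    have "((\<lambda>h. max 0 h ^ Suc n) \<longlongrightarrow> max 0 0 ^ Suc n) (at (0::real))"
      by (intro tendsto_intros)
    hence "((\<lambda>h. max 0 h ^ Suc n) \<longlongrightarrow> 0) (at (0::real))" by simp
    moreover have "\<forall>\<^sub>F h in at (0::real). norm (max 0 h ^ Suc (Suc n) / h) \<le> norm (max 0 h ^ Suc n) * 1"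
      by (intro always_eventually allI) (simp add: max_def)
    ultimately have "((\<lambda>h. max 0 h ^ Suc (Suc n) / h) \<longlongrightarrow> 0) (at (0::real))"
      by (rule tendsto_0_le)
    thus ?thesis using 3 by (simp add: DERIV_def)
  qed
qed

text \<open>Since \<open>max 0 y ^ 3\<close> has two continuous derivatives, so has
  \<open>g y = m (1 - m y ^ 3) ^ 3\<close>, which falls from 1 on y \<le> 0 to 0 on y \<ge> 1. The
  cutoff is the product of one rescaled copy falling to the left of \<open>b\<close> and one falling
  to the right of \<open>N\<close>.\<close>

lemma C2_cutoff:
  fixes b N :: real
  assumes "0 < b" "b < N"
  obtains \<phi> \<phi>1 \<phi>2 where
    "\<And>x. (\<phi> has_real_derivative \<phi>1 x) (at x)"
    "\<And>x. (\<phi>1 has_real_derivative \<phi>2 x) (at x)"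
    "continuous_on UNIV \<phi>2"
    "\<And>x. x \<in> {b..N} \<Longrightarrow> \<phi> x = 1 \<and> \<phi>1 x = 0 \<and> \<phi>2 x = 0"
    "\<And>x. x \<notin> {b/2..N+1} \<Longrightarrow> \<phi> x = 0 \<and> \<phi>1 x = 0 \<and> \<phi>2 x = 0"
proof -
  define m :: "real \<Rightarrow> real" where "m = max 0"
  have m3: "((\<lambda>y. m y ^ 3) has_real_derivative (3 * m y ^ 2)) (at y)" for y
    using has_real_derivative_pos_part_power[of 1 y] by (simp add: m_def eval_nat_numeral)
  have m2: "((\<lambda>y. m y ^ 2) has_real_derivative (2 * m y)) (at y)" for y
    using has_real_derivative_pos_part_power[of 0 y] by (simp add: m_def eval_nat_numeral)
  note ch3 = DERIV_chain2[where f = "\<lambda>y. m y ^ 3", OF m3]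
  note ch2 = DERIV_chain2[where f = "\<lambda>y. m y ^ 2", OF m2]
  have cm: "continuous_on UNIV m" unfolding m_def by (intro continuous_intros)
  define g g1 g2 :: "real \<Rightarrow> real" where
    "g = (\<lambda>y. m (1 - m y ^ 3) ^ 3)" and
    "g1 = (\<lambda>y. - 9 * m (1 - m y ^ 3) ^ 2 * m y ^ 2)" and
    "g2 = (\<lambda>y. 54 * m (1 - m y ^ 3) * m y ^ 4 - 18 * m (1 - m y ^ 3) ^ 2 * m y)"
  have g: "(g has_real_derivative g1 y) (at y)" for y
    unfolding g_def g1_def
    by (rule DERIV_cong, (rule derivative_intros ch3 m3)+) (simp add: algebra_simps)
  have g1: "(g1 has_real_derivative g2 y) (at y)" for y
    unfolding g1_def g2_def
    by (rule DERIV_cong, (rule derivative_intros ch2 m2 m3)+) (simp add: algebra_simps eval_nat_numeral)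
  have cmc: "continuous_on UNIV (\<lambda>x. m (f x))" if "continuous_on UNIV f" for f :: "real \<Rightarrow> real"
    using continuous_on_compose2[OF cm that] by simp
  have g2: "continuous_on UNIV g2"
    unfolding g2_def by (intro continuous_intros cmc)
  have g_le: "g y = 1" "g1 y = 0" "g2 y = 0" if "y \<le> 0" for y
    using that by (simp_all add: g_def g1_def g2_def m_def)
  have g_ge: "g y = 0 \<and> g1 y = 0 \<and> g2 y = 0" if "y \<ge> 1" for y
  proof -
    have "m y = y" "1 \<le> y ^ 3" using that by (auto simp: m_def intro: one_le_power)
    hence "m (1 - m y ^ 3) = 0" by (simp add: m_def)
    thus ?thesis by (simp add: g_def g1_def g2_def)
  qed
  note gch = DERIV_chain2[where f = g, OF g]
  note g1ch = DERIV_chain2[where f = g1, OF g1]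
  \<comment> \<open>\<open>l\<close> sends \<open>b\<close> to 0 and \<open>b/2\<close> to 1, so the
    support stays away from the singular point 0 of the generator.\<close>
  define l where "l = (\<lambda>x. (b - x) * (2 / b))"
  have l: "(l has_real_derivative (- (2 / b))) (at x)" for x
    unfolding l_def using assms by (auto intro!: derivative_eq_intros)
  define r where "r = (\<lambda>x. x - N)"
  have r: "(r has_real_derivative 1) (at x)" for x
    unfolding r_def by (auto intro!: derivative_eq_intros)
  define \<phi> \<phi>1 \<phi>2 where
    "\<phi> = (\<lambda>x. g (l x) * g (r x))" and
    "\<phi>1 = (\<lambda>x. - (2/b) * g1 (l x) * g (r x) + g (l x) * g1 (r x))" and
    "\<phi>2 = (\<lambda>x. (2/b)^2 * g2 (l x) * g (r x) - 2 * (2/b) * g1 (l x) * g1 (r x) + g (l x) * g2 (r x))"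
  have 1: "(\<phi> has_real_derivative \<phi>1 x) (at x)" for x
    unfolding \<phi>_def \<phi>1_def
    by (rule DERIV_cong, (rule derivative_intros gch l r)+) (simp add: algebra_simps)
  have 2: "(\<phi>1 has_real_derivative \<phi>2 x) (at x)" for x
    unfolding \<phi>1_def \<phi>2_def
    by (rule DERIV_cong, (rule derivative_intros gch g1ch l r)+) (simp add: algebra_simps power2_eq_square)
  have cg: "continuous_on UNIV g" "continuous_on UNIV g1"
    using g g1 by (meson DERIV_isCont continuous_at_imp_continuous_on)+
  have clr: "continuous_on UNIV l" "continuous_on UNIV r"
    unfolding l_def r_def by (intro continuous_intros)+
  have "continuous_on UNIV (\<lambda>x. h (l x))" "continuous_on UNIV (\<lambda>x. h (r x))"
    if "continuous_on UNIV h" for h :: "real \<Rightarrow> real"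
    using continuous_on_compose2[OF that clr(1)] continuous_on_compose2[OF that clr(2)] by auto
  note clr = this[OF cg(1)] this[OF cg(2)] this[OF g2]
  have 3: "continuous_on UNIV \<phi>2"
    unfolding \<phi>2_def by (intro continuous_intros clr)
  have 4: "\<phi> x = 1 \<and> \<phi>1 x = 0 \<and> \<phi>2 x = 0" if "x \<in> {b..N}" for x
  proof -
    have "l x \<le> 0" "r x \<le> 0"
      using that assms by (simp_all add: l_def r_def divide_nonpos_pos)
    thus ?thesis by (simp add: \<phi>_def \<phi>1_def \<phi>2_def g_le)
  qed
  have 5: "\<phi> x = 0 \<and> \<phi>1 x = 0 \<and> \<phi>2 x = 0" if "x \<notin> {b/2..N+1}" for x
  proof (cases "x < b/2")
    case True
    hence "l x \<ge> 1" using assms by (simp add: l_def field_simps)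
    from g_ge[OF this] show ?thesis by (simp add: \<phi>_def \<phi>1_def \<phi>2_def)
  next
    case False
    hence "r x \<ge> 1" using that by (simp add: r_def)
    from g_ge[OF this] show ?thesis by (simp add: \<phi>_def \<phi>1_def \<phi>2_def)
  qed
  show ?thesis by (rule that[OF 1 2 3 4 5])
qed

text \<open>Makes an admissible test function out of a \<open>v\<close> that is controlled only for
  x > 0. The product rule gives the derivatives there; left of \<open>b/2\<close> the product
  vanishes on a neighbourhood, whatever \<open>v\<close> is at such points.\<close>

lemma C2_compact_pos_cutoff:
  fixes b N :: real and v v1 v2 \<phi> \<phi>1 \<phi>2 :: "real \<Rightarrow> real"
  assumes "0 < b" "b < N"
    and \<phi>: "\<And>x. (\<phi> has_real_derivative \<phi>1 x) (at x)"
      "\<And>x. (\<phi>1 has_real_derivative \<phi>2 x) (at x)" "continuous_on UNIV \<phi>2"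
      "\<And>x. x \<notin> {b/2..N+1} \<Longrightarrow> \<phi> x = 0 \<and> \<phi>1 x = 0 \<and> \<phi>2 x = 0"
    and v: "\<And>x. x > 0 \<Longrightarrow> (v has_real_derivative v1 x) (at x)"
      "\<And>x. x > 0 \<Longrightarrow> (v1 has_real_derivative v2 x) (at x)" "continuous_on {0<..} v2"
  shows "(\<lambda>x. \<phi> x * v x) \<in> C2_compact_pos"
    and "bessel_generator \<nu> (\<lambda>x. \<phi> x * v x) x =
      1/2 * (\<phi>2 x * v x + 2 * \<phi>1 x * v1 x + \<phi> x * v2 x)
        + (2 * \<nu> + 1) / (2 * x) * (\<phi>1 x * v x + \<phi> x * v1 x)"
proof -
  define f f1 f2 where "f = (\<lambda>x. \<phi> x * v x)" and "f1 = (\<lambda>x. \<phi>1 x * v x + \<phi> x * v1 x)"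
    and "f2 = (\<lambda>x. \<phi>2 x * v x + 2 * \<phi>1 x * v1 x + \<phi> x * v2 x)"
  have zero: "f x = 0 \<and> f1 x = 0 \<and> f2 x = 0" if "x < b/2" for x
    using \<phi>(4)[of x] that by (simp add: f_def f1_def f2_def)
  have f: "(f has_real_derivative f1 x) (at x)" for x
  proof (cases "x < b/2")
    case True
    have "((\<lambda>y::real. 0) has_real_derivative 0) (at x)" by simp
    hence "(f has_real_derivative 0) (at x)"
      by (rule has_field_derivative_transform_within_open[where S = "{..<b/2}"]) (use True zero in auto)
    thus ?thesis using zero[OF True] by simp
  next
    case False
    hence "x > 0" using assms by auto
    show ?thesis unfolding f_def f1_def
      by (rule DERIV_cong, (rule derivative_intros \<phi> v \<open>x > 0\<close>)+) (simp add: algebra_simps)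
  qed
  have f1: "(f1 has_real_derivative f2 x) (at x)" for x
  proof (cases "x < b/2")
    case True
    have "((\<lambda>y::real. 0) has_real_derivative 0) (at x)" by simp
    hence "(f1 has_real_derivative 0) (at x)"
      by (rule has_field_derivative_transform_within_open[where S = "{..<b/2}"]) (use True zero in auto)
    thus ?thesis using zero[OF True] by simp
  next
    case False
    hence "x > 0" using assms by auto
    show ?thesis unfolding f1_def f2_def
      by (rule DERIV_cong, (rule derivative_intros \<phi> v \<open>x > 0\<close>)+) (simp add: algebra_simps)
  qed
  have d: "deriv f = f1" "deriv f1 = f2"
    using f f1 by (auto intro!: DERIV_imp_deriv)
  have c\<phi>: "continuous_on S \<phi>" "continuous_on S \<phi>1" "continuous_on S \<phi>2" for S
    using \<phi>(1,2) continuous_on_subset[OF \<phi>(3)]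
    by (auto intro: DERIV_isCont continuous_at_imp_continuous_on)
  have cv: "continuous_on {0<..} v" "continuous_on {0<..} v1"
    using v(1,2) by (auto intro!: continuous_at_imp_continuous_on DERIV_isCont)
  have "continuous_on {0<..} f2"
    unfolding f2_def by (intro continuous_intros c\<phi> cv v)
  moreover have "continuous_on {..<b/2} f2"
    using zero by (subst continuous_on_cong[where g = "\<lambda>_. 0"]) auto
  ultimately have "continuous_on ({0<..} \<union> {..<b/2}) f2"
    by (intro continuous_on_open_Un) auto
  moreover have "{0<..} \<union> {..<b/2} = UNIV" using assms by (auto simp: not_less)
  ultimately have cf2: "continuous_on UNIV f2" by simp
  have sub: "closure {x. f x \<noteq> 0} \<subseteq> {b/2..N+1}"
    by (rule closure_minimal) (use \<phi>(4) in \<open>auto simp: f_def\<close>, force+)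
  have "compact (closure {x. f x \<noteq> 0})"
    using sub by (meson bounded_closed_interval bounded_subset closed_closure compact_eq_bounded_closed)
  moreover have "closure {x. f x \<noteq> 0} \<subseteq> {0<..}" using sub assms by force
  ultimately have "f \<in> C2_compact_pos"
    unfolding C2_compact_pos_def using f f1 cf2
    by (auto simp: d real_differentiable_def)
  thus "(\<lambda>x. \<phi> x * v x) \<in> C2_compact_pos" by (simp add: f_def)
  show "bessel_generator \<nu> (\<lambda>x. \<phi> x * v x) x =
      1/2 * (\<phi>2 x * v x + 2 * \<phi>1 x * v1 x + \<phi> x * v2 x)
        + (2 * \<nu> + 1) / (2 * x) * (\<phi>1 x * v x + \<phi> x * v1 x)"
    unfolding bessel_generator_def f_def[symmetric] d by (simp add: f1_def f2_def)
qed

subsection \<open>Path events and martingale increments\<close>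

lemma coordinate_measurable_path_filtration:
  assumes "s \<in> {0..t}"
  shows "(\<lambda>w. w s) \<in> borel_measurable (path_filtration t)"
proof -
  have "(\<lambda>w. restrict w {0..t}) \<in> measurable (path_filtration t) (PiM {0..t} (\<lambda>_. borel :: real measure))"
    unfolding path_filtration_def
    by (rule measurable_vimage_algebra1) (auto simp: space_PiM)
  hence "(\<lambda>w. restrict w {0..t} s) \<in> borel_measurable (path_filtration t)"
    by (rule measurable_compose) (rule measurable_component_singleton[OF assms])
  thus ?thesis using assms by simp
qed

lemma coordinate_measurable_path_space:
  assumes "sets P = sets path_space" "s \<ge> 0"
  shows "(\<lambda>w. w s) \<in> borel_measurable P"
  by (rule measurable_from_subalg[OF subalgebra_path_filtration[OF assms(1), of s]])
    (rule coordinate_measurable_path_filtration, use assms(2) in simp)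

lemma continuous_on_path_space:
  "w \<in> space path_space \<Longrightarrow> continuous_on {0..} w"
  by (simp add: path_space_def space_restrict_space)

text \<open>By compactness a continuous path inside the open interval keeps a positive margin from
  both ends. With a margin \<open>1/(m+1)\<close> the condition is closed, so it may be tested on a
  countable dense set of times. \<open>M\<close> is general because the event is needed both in
  \<open>path_filtration\<close> and in the full space.\<close>

lemma sets_stays_in_interval:
  fixes b N s t :: real
  assumes X: "\<And>r. r \<in> {s..t} \<Longrightarrow> (\<lambda>w. w r) \<in> borel_measurable M"
    and cont: "\<And>w. w \<in> space M \<Longrightarrow> continuous_on {s..t} w"
  shows "{w \<in> space M. \<forall>r\<in>{s..t}. b < w r \<and> w r < N} \<in> sets M"
proof (cases "s \<le> t")
  case False
  thus ?thesis by simp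
next
  case True
  \<comment> \<open>Rational points of the unit interval, rescaled: both endpoints belong to
    \<open>D\<close> even when irrational, and \<open>s = t\<close> is covered.\<close>
  define D where "D = (\<lambda>q. s + q * (t - s)) ` (\<rat> \<inter> {0..1})"
  have D: "countable D" "D \<subseteq> {s..t}"
  proof -
    show "countable D" unfolding D_def by (intro countable_image countable_Int1 countable_rat)
    have "s + q * (t - s) \<in> {s..t}" if "0 \<le> q" "q \<le> 1" for q
      using that True mult_right_mono[of q 1 "t - s"] by auto
    thus "D \<subseteq> {s..t}" by (auto simp: D_def)
  qed
  have dense: "{s..t} \<subseteq> closure D"
  proof
    fix r assume r: "r \<in> {s..t}"
    define y where "y = (if s = t then 0 else (r - s) / (t - s))"
    have y: "y \<in> {0..1}" "r = s + y * (t - s)"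
      using r by (auto simp: y_def field_simps)
    have "{0..1::real} = closure {0<..<1}" by simp
    also have "\<dots> = closure ({0<..<1} \<inter> \<rat>)"
      by (rule closure_open_Int_superset[symmetric]) (simp_all add: Rats_closure_real)
    also have "\<dots> \<subseteq> closure (\<rat> \<inter> {0..1})"
      by (rule closure_mono) auto
    finally have "{0..1::real} \<subseteq> closure (\<rat> \<inter> {0..1})" .
    hence "y \<in> closure (\<rat> \<inter> {0..1})" using y by auto
    moreover have "(\<lambda>q. s + q * (t - s)) ` closure (\<rat> \<inter> {0..1}) \<subseteq> closure D"
      unfolding D_def by (intro image_closure_subset continuous_intros closed_closure closure_subset)
    ultimately show "r \<in> closure D" using y by blast
  qed
  have "(\<forall>r\<in>{s..t}. b < w r \<and> w r < N) \<longleftrightarrow>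
        (\<exists>m::nat. \<forall>r\<in>D. b + inverse (real (Suc m)) \<le> w r \<and> w r \<le> N - inverse (real (Suc m)))"
    if w: "w \<in> space M" for w
  proof
    assume *: "\<forall>r\<in>{s..t}. b < w r \<and> w r < N"
    obtain x where x: "x \<in> {s..t}" "\<And>r. r \<in> {s..t} \<Longrightarrow> w x \<le> w r"
      using continuous_attains_inf[of "{s..t}" w] cont[OF w] True by auto
    obtain y where y: "y \<in> {s..t}" "\<And>r. r \<in> {s..t} \<Longrightarrow> w r \<le> w y"
      using continuous_attains_sup[of "{s..t}" w] cont[OF w] True by auto
    have "min (w x - b) (N - w y) > 0" using * x y by auto
    then obtain m where m: "inverse (real (Suc m)) < min (w x - b) (N - w y)"
      using reals_Archimedean by blast
    have "b + inverse (real (Suc m)) \<le> w r \<and> w r \<le> N - inverse (real (Suc m))" if "r \<in> D" for r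
      using m x(2)[of r] y(2)[of r] that D(2) by (auto simp del: of_nat_Suc)
    thus "\<exists>m::nat. \<forall>r\<in>D. b + inverse (real (Suc m)) \<le> w r \<and> w r \<le> N - inverse (real (Suc m))"
      by blast
  next
    assume "\<exists>m::nat. \<forall>r\<in>D. b + inverse (real (Suc m)) \<le> w r \<and> w r \<le> N - inverse (real (Suc m))"
    then obtain m :: nat where
      m: "\<forall>r\<in>D. b + inverse (real (Suc m)) \<le> w r \<and> w r \<le> N - inverse (real (Suc m))" by auto
    have cl: "closure D = {s..t}"
      using dense D closure_minimal[of D "{s..t}"] by auto
    have "w ` closure D \<subseteq> {b + inverse (real (Suc m))..N - inverse (real (Suc m))}"
      by (rule image_closure_subset) (use m cont[OF w] cl in auto)
    hence *: "b + inverse (real (Suc m)) \<le> w r" "w r \<le> N - inverse (real (Suc m))" if "r \<in> {s..t}" for r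
      using that unfolding cl image_subset_iff by auto
    have "inverse (real (Suc m)) > 0" by simp
    thus "\<forall>r\<in>{s..t}. b < w r \<and> w r < N"
      using * by (smt (verit))
  qed
  hence "{w \<in> space M. \<forall>r\<in>{s..t}. b < w r \<and> w r < N} =
    (\<Union>m::nat. {w \<in> space M. \<forall>r\<in>D. b + inverse (real (Suc m)) \<le> w r \<and> w r \<le> N - inverse (real (Suc m))})"
    by auto
  also have "\<dots> \<in> sets M"
  proof -
    have "{w \<in> space M. b + inverse (real (Suc m)) \<le> w r \<and> w r \<le> N - inverse (real (Suc m))} \<in> sets M"
      if "r \<in> D" for r and m :: nat
    proof -
      have [measurable]: "(\<lambda>w. w r) \<in> borel_measurable M" using that D X by auto
      show ?thesis by measurable
    qed
    hence "{w \<in> space M. \<forall>r\<in>D. b + inverse (real (Suc m)) \<le> w r \<and> w r \<le> N - inverse (real (Suc m))} \<in> sets M"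
      for m :: nat
      by (intro sets.sets_Collect_countable_All' D(1))
    thus ?thesis by blast
  qed
  finally show ?thesis .
qed

text \<open>The integrated form of the martingale property that grid sums need: \<open>A\<close> is
  decided at time \<open>s\<close>, so over \<open>A\<close> the variable \<open>M t\<close> may be
  replaced by its conditional expectation.\<close>

lemma path_martingale_increment:
  assumes "prob_space P" "sets P = sets path_space" "path_martingale P M"
    and "0 \<le> s" "s \<le> t" "A \<in> sets (path_filtration s)"
  shows "integrable P (\<lambda>w. indicator A w * (M t w - M s w))"
    and "(\<integral>w. indicator A w * (M t w - M s w) \<partial>P) = 0"
proof -
  interpret prob_space P by fact
  have sub: "subalgebra P (path_filtration s)"
    by (rule subalgebra_path_filtration) fact
  interpret F: sigma_finite_subalgebra P "path_filtration s"
    by (rule finite_measure_subalgebra_is_sigma_finite)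
      (unfold_locales, rule sub)
  have A: "A \<in> sets P" using sub assms(6) by (auto simp: subalgebra_def)
  have int: "integrable P (M t)" "integrable P (M s)"
    using assms by (auto simp: path_martingale_def)
  note intA = integrable_mult_indicator[OF A int(1)] integrable_mult_indicator[OF A int(2)]
  show "integrable P (\<lambda>w. indicator A w * (M t w - M s w))"
    using intA by (simp add: algebra_simps)
  have ae: "AE w in P. real_cond_exp P (path_filtration s) (M t) w = M s w"
    using assms by (auto simp: path_martingale_def)
  have "(\<integral>w\<in>A. M t w \<partial>P) = (\<integral>w\<in>A. real_cond_exp P (path_filtration s) (M t) w \<partial>P)"
    by (rule F.real_cond_exp_intA) fact+
  also have "\<dots> = (\<integral>w\<in>A. M s w \<partial>P)"
    unfolding set_lebesgue_integral_def
    by (rule integral_cong_AE) (use A int ae in \<open>auto\<close>)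
  finally show "(\<integral>w. indicator A w * (M t w - M s w) \<partial>P) = 0"
    using intA by (simp add: set_lebesgue_integral_def algebra_simps)
qed

subsection \<open>Exit times\<close>

text \<open>Inserting \<open>T\<close> makes the set nonempty and caps the exit time, so that it is
  a real number; a path that never leaves the interval gets the value \<open>T\<close>.\<close>

definition exit_time :: "real \<Rightarrow> real \<Rightarrow> real \<Rightarrow> (real \<Rightarrow> real) \<Rightarrow> real" where
  "exit_time b N T w = Inf (insert T {s\<in>{0..T}. \<not> (b < w s \<and> w s < N)})"

lemma exit_time_nonneg_le:
  assumes "0 \<le> T"
  shows "0 \<le> exit_time b N T w" "exit_time b N T w \<le> T"
proof -
  show "0 \<le> exit_time b N T w"
    unfolding exit_time_def by (rule cInf_greatest) (use assms in auto)
  show "exit_time b N T w \<le> T"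
    unfolding exit_time_def
    by (rule cInf_lower) (use assms in \<open>auto intro: bdd_belowI[of _ 0]\<close>)
qed

lemma exit_time_before:
  assumes "0 \<le> r" "r < exit_time b N T w" "0 \<le> T"
  shows "b < w r" "w r < N"
proof -
  have "b < w r \<and> w r < N"
  proof (rule ccontr)
    assume *: "\<not> (b < w r \<and> w r < N)"
    have "r \<le> T" using assms exit_time_nonneg_le[of T b N w] by auto
    hence "exit_time b N T w \<le> r"
      unfolding exit_time_def using * assms
      by (intro cInf_lower bdd_belowI[of _ 0]) auto
    thus False using assms by simp
  qed
  thus "b < w r" "w r < N" by auto
qed

text \<open>By continuity the times spent outside the open interval form a closed set, which
  contains its infimum. The first alternative records both facts because the value \<open>T\<close>
  alone does not distinguish staying inside from leaving exactly at \<open>T\<close>.\<close>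

lemma exit_time_at:
  assumes w: "continuous_on {0..T} w" and "0 \<le> T"
  shows "(\<forall>s\<in>{0..T}. b < w s \<and> w s < N) \<and> exit_time b N T w = T
    \<or> \<not> (b < w (exit_time b N T w) \<and> w (exit_time b N T w) < N)"
proof (cases "\<forall>s\<in>{0..T}. b < w s \<and> w s < N")
  case True
  hence "{s\<in>{0..T}. \<not> (b < w s \<and> w s < N)} = {}" by auto
  hence "exit_time b N T w = T" unfolding exit_time_def by (simp only: cInf_singleton)
  thus ?thesis using True by blast
next
  case False
  define E where "E = {s\<in>{0..T}. \<not> (b < w s \<and> w s < N)}"
  have ne: "E \<noteq> {}" using False by (auto simp: E_def)
  have "E = {0..T} \<inter> w -` {..b} \<union> {0..T} \<inter> w -` {N..}"
    by (auto simp: E_def)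
  hence "closed E"
    using w by (auto intro!: closed_Un continuous_closed_preimage)
  moreover have bdd: "bdd_below E" by (rule bdd_belowI[of _ 0]) (simp add: E_def)
  ultimately have "Inf E \<in> E" using closed_contains_Inf ne by blast
  moreover have "Inf (insert T E) = Inf E"
    using ne bdd calculation by (subst cInf_insert) (auto simp: E_def inf_min)
  ultimately show ?thesis unfolding exit_time_def E_def by auto
qed

text \<open>Not having left by time \<open>t\<close> depends on the path up to \<open>t\<close>
  only, so its indicator may multiply a martingale increment that starts at \<open>t\<close>. The
  restriction \<open>t < T\<close> matters, as the exit time never exceeds \<open>T\<close>.\<close>

lemma exit_time_greater_iff:
  assumes w: "continuous_on {0..T} w" and "0 \<le> t" "t < T"
  shows "t < exit_time b N T w \<longleftrightarrow> (\<forall>s\<in>{0..t}. b < w s \<and> w s < N)"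
proof
  assume "t < exit_time b N T w"
  thus "\<forall>s\<in>{0..t}. b < w s \<and> w s < N"
    using assms exit_time_before[of _ b N T w] by force
next
  assume *: "\<forall>s\<in>{0..t}. b < w s \<and> w s < N"
  show "t < exit_time b N T w"
  proof (rule ccontr)
    assume "\<not> t < exit_time b N T w"
    hence "exit_time b N T w \<in> {0..t}"
      using exit_time_nonneg_le[of T b N w] assms by auto
    thus False using * exit_time_at[OF w, of b N] \<open>\<not> t < _\<close> assms by auto
  qed
qed

text \<open>Before the exit the path is in the open interval, so its exit position is in the closed
  one; if the path does leave, that position is also outside the open interval, hence an
  endpoint.\<close>

lemma exit_time_value:
  assumes w: "continuous_on {0..T} w" and "0 < T" and "b < w 0" "w 0 < N"
  shows "0 < exit_time b N T w"
    and "w (exit_time b N T w) \<in> {b..N}"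
    and "(\<forall>s\<in>{0..T}. b < w s \<and> w s < N) \<and> exit_time b N T w = T
      \<or> w (exit_time b N T w) = b \<or> w (exit_time b N T w) = N"
proof -
  let ?S = "exit_time b N T w"
  show pos: "0 < ?S"
    using exit_time_greater_iff[OF w, of 0 b N] assms by simp
  have le: "?S \<le> T" using exit_time_nonneg_le assms by simp
  have c: "continuous_on {0..?S} w"
    using w by (rule continuous_on_subset) (use le in auto)
  have cl: "closure {0..<?S} = {0..?S}" using pos by simp
  have "w ` closure {0..<?S} \<subseteq> {b..N}"
  proof (rule image_closure_subset)
    show "w ` {0..<?S} \<subseteq> {b..N}"
      using exit_time_before[of _ b N T w] assms(2) by (force intro: less_imp_le)
  qed (use c cl in auto)
  thus S: "w ?S \<in> {b..N}" using pos by (simp add: cl image_subset_iff)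
  show "(\<forall>s\<in>{0..T}. b < w s \<and> w s < N) \<and> ?S = T \<or> w ?S = b \<or> w ?S = N"
    using exit_time_at[OF w, of b N] S assms by auto
qed

subsection \<open>Time grids\<close>

definition grid :: "real \<Rightarrow> nat \<Rightarrow> nat \<Rightarrow> real" where
  "grid T n k = real k * T / real (Suc n)"

lemma grid_bounds:
  assumes "0 < T" "k \<le> Suc n"
  shows "0 \<le> grid T n k" "grid T n k \<le> T" "grid T n k \<le> grid T n (Suc k)"
proof -
  show "0 \<le> grid T n k" using assms by (simp add: grid_def)
  have "real k * T \<le> real (Suc n) * T"
    using assms by (intro mult_right_mono) auto
  thus "grid T n k \<le> T" by (simp add: grid_def field_simps del: of_nat_Suc)
  show "grid T n k \<le> grid T n (Suc k)" using assms by (simp add: grid_def field_simps)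
qed

lemma grid_0 [simp]: "grid T n 0 = 0"
  by (simp add: grid_def)

lemma grid_le_iff:
  assumes "0 < T"
  shows "grid T n k \<le> r \<longleftrightarrow> real k \<le> r * real (Suc n) / T"
    and "r \<le> grid T n k \<longleftrightarrow> r * real (Suc n) / T \<le> real k"
  using assms by (simp_all add: grid_def field_simps del: of_nat_Suc)

lemma grid_shift:
  assumes "0 < T"
  shows "(r + T / real (Suc n)) * real (Suc n) / T = r * real (Suc n) / T + 1"
    and "(r - T / real (Suc n)) * real (Suc n) / T = r * real (Suc n) / T - 1"
  using assms by (simp_all add: field_simps del: of_nat_Suc)

text \<open>\<open>m\<close> is the index of the first grid time at or after \<open>S\<close>. By
  the last claim the grid times before \<open>S\<close> form an initial segment of indices, which
  lets a stopped sum telescope.\<close>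

lemma grid_ceiling:
  fixes n :: nat
  assumes "0 < S" "S \<le> T"
  defines "m \<equiv> nat \<lceil>S * real (Suc n) / T\<rceil>"
  shows "m \<le> Suc n" "S \<le> grid T n m" "grid T n m \<le> S + T / real (Suc n)"
    "\<And>k. k < m \<longleftrightarrow> grid T n k < S"
proof -
  let ?x = "S * real (Suc n) / T"
  have T: "T > 0" using assms by auto
  have x: "0 < ?x" "?x \<le> real (Suc n)"
    using assms by (simp_all add: field_simps mult_right_mono del: of_nat_Suc)
  have m: "real m = of_int \<lceil>?x\<rceil>" unfolding m_def using x by (intro of_nat_nat) linarith
  show "m \<le> Suc n" unfolding m_def using x by linarith
  have "?x \<le> real m" "real m \<le> ?x + 1" using m by linarith+
  thus "S \<le> grid T n m" "grid T n m \<le> S + T / real (Suc n)"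
    using assms unfolding grid_le_iff[OF T] grid_shift[OF T] by simp_all
  show "k < m \<longleftrightarrow> grid T n k < S" for k
  proof -
    have "k < m \<longleftrightarrow> real k < ?x"
      unfolding m_def using x by linarith
    also have "\<dots> \<longleftrightarrow> grid T n k < S"
      unfolding not_le[symmetric] grid_le_iff[OF T] ..
    finally show ?thesis .
  qed
qed

text \<open>\<open>k\<close> is the index of the cell containing \<open>r\<close>. Its uniqueness,
  the last claim, reduces a sum over half-open cells to a single term.\<close>

lemma grid_floor:
  fixes n :: nat
  assumes "0 \<le> r" "r < T"
  defines "k \<equiv> nat \<lfloor>r * real (Suc n) / T\<rfloor>"
  shows "k < Suc n" "grid T n k \<le> r" "r < grid T n (Suc k)"
    "r - T / real (Suc n) \<le> grid T n k" "grid T n (Suc k) \<le> r + T / real (Suc n)"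
    "\<And>j. grid T n j \<le> r \<Longrightarrow> r < grid T n (Suc j) \<Longrightarrow> j = k"
proof -
  let ?x = "r * real (Suc n) / T"
  have T: "T > 0" using assms by auto
  have x: "0 \<le> ?x" "?x < real (Suc n)"
    using assms T by (auto simp: field_simps simp del: of_nat_Suc)
  show "k < Suc n" unfolding k_def using x by linarith
  have *: "real k \<le> ?x" "?x < real k + 1" unfolding k_def using x by linarith+
  thus "grid T n k \<le> r" "r < grid T n (Suc k)"
    "r - T / real (Suc n) \<le> grid T n k" "grid T n (Suc k) \<le> r + T / real (Suc n)"
    unfolding not_le[symmetric] grid_le_iff[OF T] grid_shift[OF T] by simp_all
  show "j = k" if "grid T n j \<le> r" "r < grid T n (Suc j)" for j
  proof -
    have "real j \<le> ?x" "?x < real j + 1"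
      using that unfolding not_le[symmetric] grid_le_iff[OF T] by simp_all
    with * show ?thesis by linarith
  qed
qed

lemma grid_step_tendsto_0: "(\<lambda>n. T / real (Suc n)) \<longlonglongrightarrow> 0"
  using LIMSEQ_Suc[OF lim_const_over_n[of T]] .

lemma grid_ceiling_tendsto:
  assumes "0 < S" "S \<le> T"
  shows "(\<lambda>n. grid T n (nat \<lceil>S * real (Suc n) / T\<rceil>)) \<longlonglongrightarrow> S"
proof (rule tendsto_sandwich[OF _ _ tendsto_const])
  show "(\<lambda>n. S + T / real (Suc n)) \<longlonglongrightarrow> S"
    using tendsto_add[OF tendsto_const grid_step_tendsto_0] by simp
qed (auto intro!: always_eventually grid_ceiling[OF assms] simp del: of_nat_Suc)

lemma grid_floor_tendsto:
  assumes "0 \<le> r" "r < T"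
  shows "(\<lambda>n. grid T n (nat \<lfloor>r * real (Suc n) / T\<rfloor>)) \<longlonglongrightarrow> r"
    "(\<lambda>n. grid T n (Suc (nat \<lfloor>r * real (Suc n) / T\<rfloor>))) \<longlonglongrightarrow> r"
proof -
  have "(\<lambda>n. r - T / real (Suc n)) \<longlonglongrightarrow> r - 0" "(\<lambda>n. r + T / real (Suc n)) \<longlonglongrightarrow> r + 0"
    by (intro tendsto_intros grid_step_tendsto_0)+
  note lims = this[unfolded diff_0_right add_0_right]
  have le: "\<forall>\<^sub>F n in sequentially. r - T / real (Suc n) \<le> grid T n (nat \<lfloor>r * real (Suc n) / T\<rfloor>)"
    "\<forall>\<^sub>F n in sequentially. grid T n (nat \<lfloor>r * real (Suc n) / T\<rfloor>) \<le> r"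
    "\<forall>\<^sub>F n in sequentially. r \<le> grid T n (Suc (nat \<lfloor>r * real (Suc n) / T\<rfloor>))"
    "\<forall>\<^sub>F n in sequentially. grid T n (Suc (nat \<lfloor>r * real (Suc n) / T\<rfloor>)) \<le> r + T / real (Suc n)"
    using grid_floor(2-5)[OF assms] by (auto intro: always_eventually less_imp_le simp del: of_nat_Suc)
  show "(\<lambda>n. grid T n (nat \<lfloor>r * real (Suc n) / T\<rfloor>)) \<longlonglongrightarrow> r"
    by (rule tendsto_sandwich[OF le(1,2) lims(1) tendsto_const])
  show "(\<lambda>n. grid T n (Suc (nat \<lfloor>r * real (Suc n) / T\<rfloor>))) \<longlonglongrightarrow> r"
    by (rule tendsto_sandwich[OF le(3,4) tendsto_const lims(2)])
qed

lemma grid_sum_telescope: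
  fixes F :: "nat \<Rightarrow> real"
  assumes "0 < S" "S \<le> T"
  shows "(\<Sum>k<Suc n. if grid T n k < S then F (Suc k) - F k else 0)
    = F (nat \<lceil>S * real (Suc n) / T\<rceil>) - F 0"
proof -
  define m where "m = nat \<lceil>S * real (Suc n) / T\<rceil>"
  note m = grid_ceiling[OF assms, where n = n, folded m_def]
  have "(\<Sum>k<Suc n. if grid T n k < S then F (Suc k) - F k else 0)
      = (\<Sum>k<Suc n. if k < m then F (Suc k) - F k else 0)"
    by (simp only: m(4))
  also have "\<dots> = (\<Sum>k<m. F (Suc k) - F k)"
    by (rule sum.mono_neutral_cong_right) (use m(1) in auto)
  also have "\<dots> = F m - F 0" by (rule sum_lessThan_telescope)
  finally show ?thesis by (simp add: m_def)
qed

text \<open>Dominated convergence for integrands that change from cell to cell: the sum of cell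
  integrals is the integral of one function \<open>G n\<close>, dominated by the constant
  \<open>M\<close> on \<open>{0..T}\<close>. The exceptional time \<open>S\<close> leaves room for a
  limit \<open>h\<close> that jumps when the path exits.\<close>

lemma grid_integral_tendsto:
  fixes g :: "nat \<Rightarrow> nat \<Rightarrow> real \<Rightarrow> real"
  assumes T: "0 < T"
    and int: "\<And>n k. k < Suc n \<Longrightarrow> set_integrable lborel {grid T n k..grid T n (Suc k)} (g n k)"
    and bound: "\<And>n k r. k < Suc n \<Longrightarrow> r \<in> {grid T n k..grid T n (Suc k)} \<Longrightarrow> \<bar>g n k r\<bar> \<le> M"
    and h: "set_borel_measurable lborel {0..T} h"
    and lim: "\<And>r. 0 < r \<Longrightarrow> r < T \<Longrightarrow> r \<noteq> S \<Longrightarrow>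
       (\<lambda>n. g n (nat \<lfloor>r * real (Suc n) / T\<rfloor>) r) \<longlonglongrightarrow> h r"
  shows "(\<lambda>n. \<Sum>k<Suc n. LBINT r:{grid T n k..grid T n (Suc k)}. g n k r) \<longlonglongrightarrow> (LBINT r:{0..T}. h r)"
    and "\<bar>\<Sum>k<Suc n. LBINT r:{grid T n k..grid T n (Suc k)}. g n k r\<bar> \<le> M * T"
proof -
  \<comment> \<open>Half-open cells are disjoint, so each \<open>r\<close> meets one summand; the
    closed cells differ from them by null sets.\<close>
  define G where "G n r = (\<Sum>k<Suc n. indicator {grid T n k..<grid T n (Suc k)} r * g n k r)" for n r
  have M: "0 \<le> M"
    using bound[of 0 0 0] T by (force simp: grid_def)
  have int': "set_integrable lborel {grid T n k..<grid T n (Suc k)} (g n k)" if "k < Suc n" for n k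
    by (rule set_integrable_subset[OF int[OF that]]) auto
  have intG: "integrable lborel (G n)" for n
    unfolding G_def using int' by (intro Bochner_Integration.integrable_sum)
      (auto simp: set_integrable_def)
  have G_eq: "G n r = g n (nat \<lfloor>r * real (Suc n) / T\<rfloor>) r" if "0 \<le> r" "r < T" for n r
  proof -
    define j where "j = nat \<lfloor>r * real (Suc n) / T\<rfloor>"
    note j = grid_floor[OF that, where n = n, folded j_def]
    have "G n r = (\<Sum>k\<in>{j}. indicator {grid T n k..<grid T n (Suc k)} r * g n k r)"
      unfolding G_def
    proof (rule sum.mono_neutral_right)
      show "\<forall>k\<in>{..<Suc n} - {j}. indicator {grid T n k..<grid T n (Suc k)} r * g n k r = 0"
        using j(6) by (metis DiffD2 atLeastLessThan_iff indicator_simps(2) mult_zero_left singletonI)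
    qed (use j(1) in auto)
    thus ?thesis unfolding j_def[symmetric] using j(2,3) by simp
  qed
  have G_0: "G n r = 0" if "\<not> (0 \<le> r \<and> r < T)" for n r
    unfolding G_def
  proof (intro sum.neutral ballI)
    fix k assume "k \<in> {..<Suc n}"
    thus "indicator {grid T n k..<grid T n (Suc k)} r * g n k r = 0"
      using grid_bounds[OF T, of k n] grid_bounds[OF T, of "Suc k" n] that by (auto simp: indicator_def)
  qed
  have G_bound: "\<bar>G n r\<bar> \<le> M * indicator {0..T} r" for n r
  proof (cases "0 \<le> r \<and> r < T")
    case True
    hence "r \<in> {0..T}" by auto
    moreover have "\<bar>G n r\<bar> \<le> M"
      using True grid_floor(1-3)[of r T n]
      by (subst G_eq) (auto intro!: bound intro: less_imp_le simp del: of_nat_Suc)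
    ultimately show ?thesis by simp
  next
    case False
    thus ?thesis using G_0[OF False, of n] M by (simp add: indicator_def)
  qed
  have eq: "(\<Sum>k<Suc n. LBINT r:{grid T n k..grid T n (Suc k)}. g n k r) = integral\<^sup>L lborel (G n)" for n
  proof -
    have "(LBINT r:{grid T n k..grid T n (Suc k)}. g n k r)
        = (LBINT r:{grid T n k..<grid T n (Suc k)}. g n k r)" if "k < Suc n" for k
      unfolding set_lebesgue_integral_def
    proof (rule integral_cong_AE)
      show "AE r in lborel. indicator {grid T n k..grid T n (Suc k)} r *\<^sub>R g n k r
          = indicator {grid T n k..<grid T n (Suc k)} r *\<^sub>R g n k r"
        using AE_lborel_singleton[of "grid T n (Suc k)"] by eventually_elim (auto simp: indicator_def)
    qed (use int[OF that] int'[OF that] in \<open>auto simp: set_integrable_def\<close>)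
    hence "(\<Sum>k<Suc n. LBINT r:{grid T n k..grid T n (Suc k)}. g n k r)
        = (\<Sum>k<Suc n. LBINT r:{grid T n k..<grid T n (Suc k)}. g n k r)"
      by (intro sum.cong) auto
    also have "\<dots> = integral\<^sup>L lborel (G n)"
      unfolding G_def set_lebesgue_integral_def using int'
      by (subst Bochner_Integration.integral_sum) (auto simp: set_integrable_def)
    finally show ?thesis .
  qed
  have bI: "integrable lborel (\<lambda>r. M * indicator {0..T} r)"
    using T by (intro integrable_mult_right integrable_real_indicator) auto
  have "(\<lambda>n. integral\<^sup>L lborel (G n)) \<longlonglongrightarrow> integral\<^sup>L lborel (\<lambda>r. indicator {0..T} r *\<^sub>R h r)"
  proof (rule integral_dominated_convergence[OF _ _ bI])
    show "AE r in lborel. (\<lambda>n. G n r) \<longlonglongrightarrow> indicator {0..T} r *\<^sub>R h r"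
      using AE_lborel_singleton[of 0] AE_lborel_singleton[of T] AE_lborel_singleton[of S]
    proof eventually_elim
      case (elim r)
      show ?case
      proof (cases "0 \<le> r \<and> r < T")
        case True
        thus ?thesis using lim[of r] elim by (simp add: G_eq del: of_nat_Suc)
      next
        case False
        thus ?thesis using G_0[OF False] elim by (auto simp: indicator_def)
      qed
    qed
    show "AE r in lborel. norm (G n r) \<le> M * indicator {0..T} r" for n
      using G_bound by simp
  qed (use h intG in \<open>auto simp: set_borel_measurable_def\<close>)
  thus "(\<lambda>n. \<Sum>k<Suc n. LBINT r:{grid T n k..grid T n (Suc k)}. g n k r) \<longlonglongrightarrow> (LBINT r:{0..T}. h r)"
    unfolding eq by (simp only: set_lebesgue_integral_def)
  have "\<bar>integral\<^sup>L lborel (G n)\<bar> \<le> integral\<^sup>L lborel (\<lambda>r. \<bar>G n r\<bar>)"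
    by (rule integral_abs_bound)
  also have "\<dots> \<le> integral\<^sup>L lborel (\<lambda>r. M * indicator {0..T} r)"
    using intG G_bound by (intro integral_mono bI) auto
  also have "\<dots> = M * T" using T by simp
  finally show "\<bar>\<Sum>k<Suc n. LBINT r:{grid T n k..grid T n (Suc k)}. g n k r\<bar> \<le> M * T"
    by (simp only: eq)
qed

subsection \<open>Dynkin's formula up to an exit time\<close>

text \<open>\<open>X\<close> and \<open>I\<close> are delivered as random variables, described only
  on paths that start at \<open>a\<close>, because their measurability comes from the construction:
  both are pointwise limits of measurable grid sums, and on the null set of other starting points
  they are filled in by constants.\<close>

lemma dynkin_exit:
  fixes \<nu> a b N T :: real and V Vx Vxx Vt :: "real \<Rightarrow> real \<Rightarrow> real"
    and P :: "(real \<Rightarrow> real) measure"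
  assumes law: "bessel_law \<nu> a P" and ab: "0 < b" "b < a" "a < N" and T: "0 < T"
    and dx: "\<And>x t. 0 < x \<Longrightarrow> t \<in> {0..T} \<Longrightarrow> ((\<lambda>x. V x t) has_real_derivative Vx x t) (at x)"
    and dxx: "\<And>x t. 0 < x \<Longrightarrow> t \<in> {0..T} \<Longrightarrow> ((\<lambda>x. Vx x t) has_real_derivative Vxx x t) (at x)"
    and dt: "\<And>x t. 0 < x \<Longrightarrow> t \<in> {0..T} \<Longrightarrow> (V x has_real_derivative Vt x t) (at t)"
    and cV: "continuous_on ({0<..} \<times> {0..T}) (\<lambda>p. V (fst p) (snd p))"
    and cVx: "continuous_on ({0<..} \<times> {0..T}) (\<lambda>p. Vx (fst p) (snd p))"
    and cVxx: "continuous_on ({0<..} \<times> {0..T}) (\<lambda>p. Vxx (fst p) (snd p))"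
    and cVt: "continuous_on ({0<..} \<times> {0..T}) (\<lambda>p. Vt (fst p) (snd p))"
  obtains X I where "integrable P X" "integrable P I" "integral\<^sup>L P X = V a 0 + integral\<^sup>L P I"
    "\<And>w. w \<in> space P \<Longrightarrow> w 0 = a \<Longrightarrow> X w = V (w (exit_time b N T w)) (exit_time b N T w)"
    "\<And>w. w \<in> space P \<Longrightarrow> w 0 = a \<Longrightarrow> I w = (LBINT r:{0..exit_time b N T w}.
        1/2 * Vxx (w r) r + (2 * \<nu> + 1) / (2 * w r) * Vx (w r) r + Vt (w r) r)"
proof -
  have prob: "prob_space P" and sets_P: "sets P = sets path_space" and start: "AE w in P. w 0 = a"
    using law by (auto simp: bessel_law_def)
  interpret prob_space P by (rule prob)
  have space_P: "space P = space path_space" by (rule sets_eq_imp_space_eq[OF sets_P])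
  note coord = coordinate_measurable_path_space[OF sets_P]

  \<comment> \<open>Space-time functions cut off near 0 and above the barrier\<close>
  obtain \<phi> \<phi>1 \<phi>2 where \<phi>:
    "\<And>x. (\<phi> has_real_derivative \<phi>1 x) (at x)"
    "\<And>x. (\<phi>1 has_real_derivative \<phi>2 x) (at x)"
    "continuous_on UNIV \<phi>2"
    "\<And>x. x \<in> {b..N} \<Longrightarrow> \<phi> x = 1 \<and> \<phi>1 x = 0 \<and> \<phi>2 x = 0"
    "\<And>x. x \<notin> {b/2..N+1} \<Longrightarrow> \<phi> x = 0 \<and> \<phi>1 x = 0 \<and> \<phi>2 x = 0"
    by (rule C2_cutoff[of b N]) (use ab in auto)
  have c\<phi>: "continuous_on UNIV \<phi>" "continuous_on UNIV \<phi>1" "continuous_on UNIV \<phi>2"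
    using \<phi>(1,2,3) by (auto intro: DERIV_isCont continuous_at_imp_continuous_on)

  \<comment> \<open>\<open>L x t\<close> is the generator applied to the cut-off function
    \<open>f t\<close> at frozen time \<open>t\<close>, and \<open>K\<close> is the space-time drift
    of \<open>V\<close> itself. On \<open>{b..N}\<close> the cutoff is constant, so
    \<open>L + Vt = K\<close> there.\<close>
  define L where "L x t = 1/2 * (\<phi>2 x * V x t + 2 * \<phi>1 x * Vx x t + \<phi> x * Vxx x t)
      + (2 * \<nu> + 1) / (2 * x) * (\<phi>1 x * V x t + \<phi> x * Vx x t)" for x t
  define K where "K x t = 1/2 * Vxx x t + (2 * \<nu> + 1) / (2 * x) * Vx x t + Vt x t" for x t
  define f where "f t x = \<phi> x * V x t" for t x
  have slice: "continuous_on {0<..} (\<lambda>x. U x t)"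
    if "continuous_on ({0<..} \<times> {0..T}) (\<lambda>p. U (fst p) (snd p))" "t \<in> {0..T}"
    for U :: "real \<Rightarrow> real \<Rightarrow> real" and t
    using continuous_on_compose2[OF that(1), of "{0<..}" "\<lambda>x. (x, t)"] that(2)
    by (simp add: continuous_on_Pair image_subset_iff)
  have f: "f t \<in> C2_compact_pos" and gen: "bessel_generator \<nu> (f t) = (\<lambda>x. L x t)"
    if t: "t \<in> {0..T}" for t
  proof -
    have "b < N" using ab by simp
    note * = C2_compact_pos_cutoff[OF ab(1) this \<phi>(1,2,3,5) dx[OF _ t] dxx[OF _ t] slice[OF cVxx t]]
    show "f t \<in> C2_compact_pos" unfolding f_def using *(1) by simp
    show "bessel_generator \<nu> (f t) = (\<lambda>x. L x t)" unfolding f_def L_def using *(2)[of \<nu>] by blast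
  qed
  have cL: "continuous_on UNIV (\<lambda>x. L x t)" if t: "t \<in> {0..T}" for t
  proof -
    have "continuous_on {0<..} (\<lambda>x. L x t)"
      unfolding L_def using c\<phi>[THEN continuous_on_subset, OF subset_UNIV]
      by (intro continuous_intros slice[OF cV t] slice[OF cVx t] slice[OF cVxx t]) auto
    moreover have "continuous_on {..<b/2} (\<lambda>x. L x t)"
      using \<phi>(5) by (subst continuous_on_cong[where g = "\<lambda>_. 0"]) (auto simp: L_def)
    ultimately have "continuous_on ({0<..} \<union> {..<b/2}) (\<lambda>x. L x t)"
      by (intro continuous_on_open_Un) auto
    moreover have "{0<..} \<union> {..<b/2} = UNIV" using ab by (auto simp: not_less)
    ultimately show ?thesis by simp
  qed
  have cf: "continuous_on UNIV (f t)" if "t \<in> {0..T}" for t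
    using f[OF that] by (auto simp: C2_compact_pos_def intro!: continuous_at_imp_continuous_on
        differentiable_imp_continuous_within)
  have c\<phi>': "continuous_on S (\<lambda>p. \<phi> (fst p))" "continuous_on S (\<lambda>p. \<phi>1 (fst p))"
    "continuous_on S (\<lambda>p. \<phi>2 (fst p))" for S :: "(real \<times> real) set"
    using c\<phi>[THEN continuous_on_compose2, of S fst] by (simp_all add: continuous_on_fst)
  have cL': "continuous_on ({0<..} \<times> {0..T}) (\<lambda>p. L (fst p) (snd p))"
    unfolding L_def by (intro continuous_intros c\<phi>' cV cVx cVxx) auto
  have cK': "continuous_on ({0<..} \<times> {0..T}) (\<lambda>p. K (fst p) (snd p))"
    unfolding K_def by (intro continuous_intros cVt cVx cVxx) auto
  have cf': "continuous_on ({0<..} \<times> {0..T}) (\<lambda>p. f (snd p) (fst p))"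
    unfolding f_def by (intro continuous_intros c\<phi>' cV)

  have bound: "\<exists>M. \<forall>x\<in>{b/2..N+1}. \<forall>t\<in>{0..T}. \<bar>U x t\<bar> \<le> M"
    if "continuous_on ({0<..} \<times> {0..T}) (\<lambda>p. U (fst p) (snd p))" for U :: "real \<Rightarrow> real \<Rightarrow> real"
  proof -
    have "compact ((\<lambda>p. U (fst p) (snd p)) ` ({b/2..N+1} \<times> {0..T}))"
      by (intro compact_continuous_image continuous_on_subset[OF that] compact_Times) (use ab in auto)
    hence "bounded ((\<lambda>p. U (fst p) (snd p)) ` ({b/2..N+1} \<times> {0..T}))"
      by (rule compact_imp_bounded)
    then obtain M where M: "\<And>y. y \<in> (\<lambda>p. U (fst p) (snd p)) ` ({b/2..N+1} \<times> {0..T}) \<Longrightarrow> norm y \<le> M"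
      unfolding bounded_iff by blast
    have "\<bar>U x t\<bar> \<le> M" if "x \<in> {b/2..N+1}" "t \<in> {0..T}" for x t
      using M[of "U x t"] that by force
    thus ?thesis by blast
  qed
  \<comment> \<open>Between the exit and the next grid time the path may be anywhere, so
    \<open>L\<close> and \<open>f\<close> need bounds on the whole line, which the cutoff provides.
    \<open>Vt\<close> will be evaluated only at positions inside the interval.\<close>
  obtain BL where "\<forall>x\<in>{b/2..N+1}. \<forall>t\<in>{0..T}. \<bar>L x t\<bar> \<le> BL" using bound[OF cL'] by blast
  moreover have "L x t = 0" if "x \<notin> {b/2..N+1}" for x t using \<phi>(5)[OF that] by (simp add: L_def)
  ultimately have BL: "\<bar>L x t\<bar> \<le> \<bar>BL\<bar>" if "t \<in> {0..T}" for x t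
    using that by (metis abs_0 abs_ge_zero abs_of_nonneg dual_order.trans)
  obtain Bf where "\<forall>x\<in>{b/2..N+1}. \<forall>t\<in>{0..T}. \<bar>f t x\<bar> \<le> Bf" using bound[OF cf'] by blast
  moreover have "f t x = 0" if "x \<notin> {b/2..N+1}" for x t using \<phi>(5)[OF that] by (simp add: f_def)
  ultimately have Bf: "\<bar>f t x\<bar> \<le> \<bar>Bf\<bar>" if "t \<in> {0..T}" for x t
    using that by (metis abs_0 abs_ge_zero abs_of_nonneg dual_order.trans)
  obtain Bt where Bt: "\<forall>x\<in>{b/2..N+1}. \<forall>t\<in>{0..T}. \<bar>Vt x t\<bar> \<le> Bt" using bound[OF cVt] by blast

  \<comment> \<open>Martingale increments on the time grid\<close>
  define M where "M t s w = f t (w s) - (LBINT r:{0..s}. L (w r) t)" for t s and w :: "real \<Rightarrow> real"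
  have mart: "path_martingale P (M t)" if "t \<in> {0..T}" for t
  proof -
    have "path_martingale P (\<lambda>s w. f t (w s) - (LBINT r:{0..s}. bessel_generator \<nu> (f t) (w r)))"
      using law f[OF that] unfolding bessel_law_def by blast
    thus ?thesis unfolding M_def[abs_def] gen[OF that] .
  qed
  \<comment> \<open>\<open>A n k\<close> says that the path has not left by the \<open>k\<close>-th
    grid time. Keeping only the increments on these events stops the sum at the first grid time by
    which the exit has occurred.\<close>
  define A where "A n k = {w \<in> space path_space. \<forall>r\<in>{0..grid T n k}. b < w r \<and> w r < N}" for n k
  have A: "A n k \<in> sets (path_filtration (grid T n k))" for n k
  proof -
    have "space (path_filtration (grid T n k)) = space path_space" by (simp add: path_filtration_def)
    moreover have "continuous_on {0..grid T n k} w" if "w \<in> space path_space" for w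
      by (rule continuous_on_subset[OF continuous_on_path_space[OF that]]) auto
    ultimately show ?thesis unfolding A_def
      using sets_stays_in_interval[where s = 0 and t = "grid T n k" and M = "path_filtration (grid T n k)",
          OF coordinate_measurable_path_filtration] by simp
  qed
  have A_P: "A n k \<in> sets P" for n k
    using A[of n k] subalgebra_path_filtration[OF sets_P, of "grid T n k"] by (auto simp: subalgebra_def)
  have g01: "grid T n k \<in> {0..T}" "grid T n (Suc k) \<in> {0..T}" "grid T n k \<le> grid T n (Suc k)"
    "0 \<le> grid T n k" "0 \<le> grid T n (Suc k)" if "k < Suc n" for n k
    using grid_bounds[OF T, of k n] grid_bounds[OF T, of "Suc k" n] that by auto
  \<comment> \<open>Over the cell \<open>k\<close> the time argument is frozen at the right end, so
    \<open>Z n k\<close> is an increment of one single martingale.\<close>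
  define Z where "Z n k w = M (grid T n (Suc k)) (grid T n (Suc k)) w - M (grid T n (Suc k)) (grid T n k) w"
    for n k and w :: "real \<Rightarrow> real"
  have Z: "integrable P (\<lambda>w. indicator (A n k) w * Z n k w)" "(\<integral>w. indicator (A n k) w * Z n k w \<partial>P) = 0"
    if k: "k < Suc n" for n k
    unfolding Z_def
    using path_martingale_increment[OF prob sets_P mart g01(4)[OF k] g01(3)[OF k] A] g01(2)[OF k] by blast+
  \<comment> \<open>The pathwise identities and bounds below need the start \<open>a\<close>.
    Multiplying by the indicator of this almost sure event makes the bounds hold for every
    path.\<close>
  define G where "G = {w \<in> space P. w 0 = a}"
  have G: "G \<in> sets P" unfolding G_def using coord[of 0] by measurable
  define Xn where "Xn n w = indicator G w * (\<Sum>k<Suc n. indicator (A n k) w *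
      (f (grid T n (Suc k)) (w (grid T n (Suc k))) - f (grid T n k) (w (grid T n k))))"
    for n and w :: "real \<Rightarrow> real"
  define Zn where "Zn n w = indicator G w * (\<Sum>k<Suc n. indicator (A n k) w * Z n k w)"
    for n and w :: "real \<Rightarrow> real"
  have Zn: "integrable P (Zn n)" "(\<integral>w. Zn n w \<partial>P) = 0" for n
  proof -
    have int: "integrable P (\<lambda>w. \<Sum>k<Suc n. indicator (A n k) w * Z n k w)"
      by (intro Bochner_Integration.integrable_sum Z) auto
    show "integrable P (Zn n)" unfolding Zn_def using integrable_mult_indicator[OF G int] by simp
    have "(\<integral>w. Zn n w \<partial>P) = (\<integral>w. (\<Sum>k<Suc n. indicator (A n k) w * Z n k w) \<partial>P)"
    proof (rule integral_cong_AE)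
      show "AE w in P. Zn n w = (\<Sum>k<Suc n. indicator (A n k) w * Z n k w)"
        using start AE_space by eventually_elim (simp add: Zn_def G_def)
    qed (use int \<open>integrable P (Zn n)\<close> in auto)
    also have "\<dots> = 0"
      using Z by (subst Bochner_Integration.integral_sum) auto
    finally show "(\<integral>w. Zn n w \<partial>P) = 0" .
  qed
  have Xn_meas: "Xn n \<in> borel_measurable P" for n
    unfolding Xn_def
  proof (intro borel_measurable_times borel_measurable_sum borel_measurable_diff
      borel_measurable_indicator G A_P)
    fix k assume "k \<in> {..<Suc n}"
    hence k: "k < Suc n" by simp
    show "(\<lambda>w. f (grid T n (Suc k)) (w (grid T n (Suc k)))) \<in> borel_measurable P"
      using measurable_compose[OF coord[OF g01(5)[OF k]] borel_measurable_continuous_onI[OF cf[OF g01(2)[OF k]]]] .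
    show "(\<lambda>w. f (grid T n k) (w (grid T n k))) \<in> borel_measurable P"
      using measurable_compose[OF coord[OF g01(4)[OF k]] borel_measurable_continuous_onI[OF cf[OF g01(1)[OF k]]]] .
  qed

  \<comment> \<open>The limit of the grid sums along a fixed path\<close>
  define S where "S = exit_time b N T"
  define q where "q w n k r = (if grid T n k < S w
      then L (w r) (grid T n (Suc k)) + Vt (w (grid T n k)) r else 0)" for w n k r
  \<comment> \<open>Pointwise limits together with bounds independent of path and grid: the input
    for dominated convergence under \<open>P\<close>.\<close>
  have path: "(\<lambda>n. Xn n w) \<longlonglongrightarrow> V (w (S w)) (S w) - V a 0" "\<bar>Xn n w\<bar> \<le> 2 * \<bar>Bf\<bar>"
    "(\<lambda>n. Xn n w - Zn n w) \<longlonglongrightarrow> (LBINT r:{0..S w}. K (w r) r)"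
    "\<bar>Xn n w - Zn n w\<bar> \<le> (\<bar>BL\<bar> + \<bar>Bt\<bar>) * T"
    if w: "w \<in> G" for w n
  proof -
    have w0: "w 0 = a" and wsp: "w \<in> space path_space" using w by (auto simp: G_def space_P)
    have wc: "continuous_on {0..} w" using continuous_on_path_space[OF wsp] .
    have wcT: "continuous_on {0..T} w" by (rule continuous_on_subset[OF wc]) auto
    have bN: "b < w 0" "w 0 < N" using w0 ab by auto
    have S: "0 < S w" "S w \<le> T" "w (S w) \<in> {b..N}"
      using exit_time_value[OF wcT T bN] exit_time_nonneg_le[of T b N w] T by (auto simp: S_def)
    have before: "w r \<in> {b<..<N}" if "0 \<le> r" "r < S w" for r
      using exit_time_before[of r b N T w] that T by (auto simp: S_def)
    have ind: "indicator (A n k) w = (if grid T n k < S w then 1 else (0::real))" if "k < Suc n" for n k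
    proof -
      have "real k * T < real (Suc n) * T" using that T by (intro mult_strict_right_mono) auto
      hence "grid T n k < T" by (simp add: grid_def field_simps del: of_nat_Suc)
      from exit_time_greater_iff[OF wcT g01(4)[OF that] this, of b N]
      show ?thesis using wsp by (simp add: A_def S_def)
    qed
    define F where "F n j = f (grid T n j) (w (grid T n j))" for n j
    define m where "m n = nat \<lceil>S w * real (Suc n) / T\<rceil>" for n
    note m = grid_ceiling[OF S(1,2), folded m_def]
    have Xn_eq: "Xn n w = F n (m n) - F n 0" for n
    proof -
      have "Xn n w = (\<Sum>k<Suc n. if grid T n k < S w then F n (Suc k) - F n k else 0)"
        unfolding Xn_def F_def using w by (auto simp: ind intro!: sum.cong)
      thus ?thesis using grid_sum_telescope[OF S(1,2)] by (simp only: m_def)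
    qed
    have gm: "grid T n (m n) \<in> {0..T}" for n
      using grid_bounds[OF T m(1)] by auto
    have gm_lim: "(\<lambda>n. grid T n (m n)) \<longlonglongrightarrow> S w"
      unfolding m_def by (rule grid_ceiling_tendsto[OF S(1,2)])
    have w_lim: "(\<lambda>n. w (h n)) \<longlonglongrightarrow> w r" if "h \<longlonglongrightarrow> r" "0 \<le> r" "\<And>n. 0 \<le> h n" for h r
      by (rule continuous_on_tendsto_compose[OF wc that(1)]) (use that in auto)
    have F_lim: "(\<lambda>n. F n (m n)) \<longlonglongrightarrow> f (S w) (w (S w))"
    proof -
      have wm: "(\<lambda>n. w (grid T n (m n))) \<longlonglongrightarrow> w (S w)"
        by (rule w_lim[OF gm_lim]) (use gm S in auto)
      have "\<forall>\<^sub>F n in sequentially. 0 < w (grid T n (m n))"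
        by (rule order_tendstoD[OF wm]) (use S ab in auto)
      hence ev: "\<forall>\<^sub>F n in sequentially. (w (grid T n (m n)), grid T n (m n)) \<in> {0<..} \<times> {0..T}"
        by eventually_elim (use gm in auto)
      have "(w (S w), S w) \<in> {0<..} \<times> {0..T}" using S ab by auto
      from continuous_on_tendsto_compose[OF cf' tendsto_Pair[OF wm gm_lim] this ev]
      show ?thesis by (simp add: F_def)
    qed
    have "\<phi> (w (S w)) = 1" "\<phi> a = 1" using \<phi>(4) S(3) ab by auto
    hence "f (S w) (w (S w)) = V (w (S w)) (S w)" "F n 0 = V a 0" for n
      using w0 by (auto simp: f_def F_def)
    thus "(\<lambda>n. Xn n w) \<longlonglongrightarrow> V (w (S w)) (S w) - V a 0"
      using F_lim by (auto simp: Xn_eq intro!: tendsto_intros)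
    show "\<bar>Xn n w\<bar> \<le> 2 * \<bar>Bf\<bar>"
      using Bf[OF gm, of n "w (grid T n (m n))"] Bf[of 0 "w 0"] T by (simp add: Xn_eq F_def)

    have int_L: "set_integrable lborel {s..s'} (\<lambda>r. L (w r) t)" if "t \<in> {0..T}" "0 \<le> s" for s s' t
    proof (rule borel_integrable_atLeastAtMost')
      show "continuous_on {s..s'} (\<lambda>r. L (w r) t)"
        by (rule continuous_on_compose2[OF cL[OF that(1)]])
          (use that in \<open>auto intro: continuous_on_subset[OF wc]\<close>)
    qed
    have int_Vt: "set_integrable lborel {s..s'} (\<lambda>r. Vt x r)" if "0 < x" "0 \<le> s" "s' \<le> T" for s s' x
    proof (rule borel_integrable_atLeastAtMost')
      show "continuous_on {s..s'} (\<lambda>r. Vt x r)"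
        using continuous_on_compose2[OF cVt, of "{s..s'}" "\<lambda>r. (x, r)"] that
        by (simp add: continuous_on_Pair image_subset_iff)
    qed
    \<comment> \<open>The increment is split at the intermediate value with new time and old
      position. The change in position is \<open>Z n k\<close> plus the integral of
      \<open>L\<close>; the change in time is the integral of \<open>Vt\<close> by the fundamental
      theorem of calculus, the cutoff being 1 at the old position.\<close>
    have YZ: "indicator (A n k) w * (F n (Suc k) - F n k) - indicator (A n k) w * Z n k w
        = (LBINT r:{grid T n k..grid T n (Suc k)}. q w n k r)" if k: "k < Suc n" for n k
    proof (cases "grid T n k < S w")
      case False
      thus ?thesis using ind[OF k] by (simp add: q_def set_lebesgue_integral_def)
    next
      case True
      define s t where "s = grid T n k" and "t = grid T n (Suc k)"
      have st: "s \<in> {0..T}" "t \<in> {0..T}" "s \<le> t" using g01[OF k] by (auto simp: s_def t_def)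
      have ws: "w s \<in> {b<..<N}" using before[of s] True st by (auto simp: s_def)
      hence ws0: "0 < w s" "\<phi> (w s) = 1" using ab \<phi>(4)[of "w s"] by auto
      have half: "set_integrable lborel {s<..t} (\<lambda>r. L (w r) t)"
        by (rule set_integrable_subset[OF int_L[of t s t]]) (use st in auto)
      have "(LBINT r:{0..t}. L (w r) t) = (LBINT r:{0..s} \<union> {s<..t}. L (w r) t)"
        using st by (intro arg_cong[where f = "\<lambda>A. LBINT r:A. L (w r) t"]) auto
      also have "\<dots> = (LBINT r:{0..s}. L (w r) t) + (LBINT r:{s<..t}. L (w r) t)"
        using st by (intro set_integral_Un int_L half) auto
      also have "(LBINT r:{s<..t}. L (w r) t) = (LBINT r:{s..t}. L (w r) t)"
        unfolding set_lebesgue_integral_def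
      proof (rule integral_cong_AE)
        show "AE r in lborel. indicator {s<..t} r *\<^sub>R L (w r) t = indicator {s..t} r *\<^sub>R L (w r) t"
          using AE_lborel_singleton[of s] by eventually_elim (auto simp: indicator_def)
      qed (use int_L[of t s t] half st in \<open>auto simp: set_integrable_def dest: borel_measurable_integrable\<close>)
      finally have iL: "(LBINT r:{0..t}. L (w r) t) - (LBINT r:{0..s}. L (w r) t) = (LBINT r:{s..t}. L (w r) t)"
        by simp
      have iV: "(LBINT r:{s..t}. Vt (w s) r) = V (w s) t - V (w s) s"
        unfolding set_lebesgue_integral_def
      proof (rule integral_FTC_atLeastAtMost)
        show "s \<le> t" by (rule st)
        show "(V (w s) has_vector_derivative Vt (w s) r) (at r within {s..t})" if "s \<le> r" "r \<le> t" for r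
          using dt[OF ws0(1), of r] that st
          by (auto simp: has_real_derivative_iff_has_vector_derivative intro: has_vector_derivative_at_within)
        show "continuous_on {s..t} (Vt (w s))"
          using continuous_on_compose2[OF cVt, of "{s..t}" "\<lambda>r. (w s, r)"] ws0 st
          by (simp add: continuous_on_Pair image_subset_iff)
      qed
      have "indicator (A n k) w * (F n (Suc k) - F n k) - indicator (A n k) w * Z n k w
          = (LBINT r:{s..t}. L (w r) t) + (LBINT r:{s..t}. Vt (w s) r)"
        using True ind[OF k] iL
        by (simp add: F_def Z_def M_def iV s_def[symmetric] t_def[symmetric]) (simp add: f_def ws0)
      also have "\<dots> = (LBINT r:{s..t}. L (w r) t + Vt (w s) r)"
        using st ws0 by (intro set_integral_add(2)[symmetric] int_L int_Vt) auto
      finally show ?thesis using True by (simp add: q_def s_def t_def)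
    qed
    have Yn_eq: "Xn n w - Zn n w = (\<Sum>k<Suc n. LBINT r:{grid T n k..grid T n (Suc k)}. q w n k r)" for n
    proof -
      have "Xn n w - Zn n w = (\<Sum>k<Suc n. indicator (A n k) w * (F n (Suc k) - F n k) - indicator (A n k) w * Z n k w)"
        unfolding Xn_def Zn_def F_def using w by (simp only: sum_subtractf indicator_simps mult_1)
      also have "\<dots> = (\<Sum>k<Suc n. LBINT r:{grid T n k..grid T n (Suc k)}. q w n k r)"
        by (intro sum.cong YZ) auto
      finally show ?thesis .
    qed
    \<comment> \<open>Cells starting after the exit contribute nothing, and the cell containing the
      exit shrinks to a point; hence the limit integrand breaks off at \<open>S w\<close>.\<close>
    define h where "h r = (if r < S w then K (w r) r else 0)" for r
    have int_q: "set_integrable lborel {grid T n k..grid T n (Suc k)} (q w n k)" if k: "k < Suc n" for n k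
    proof (cases "grid T n k < S w")
      case True
      hence "0 < w (grid T n k)" using before[of "grid T n k"] g01[OF k] ab by auto
      hence "set_integrable lborel {grid T n k..grid T n (Suc k)}
          (\<lambda>r. L (w r) (grid T n (Suc k)) + Vt (w (grid T n k)) r)"
        using g01[OF k] by (intro set_integral_add(1) int_L int_Vt) auto
      thus ?thesis using True by (simp add: q_def[abs_def])
    qed (simp add: q_def set_integrable_def)
    have bound_q: "\<bar>q w n k r\<bar> \<le> \<bar>BL\<bar> + \<bar>Bt\<bar>"
      if k: "k < Suc n" and r: "r \<in> {grid T n k..grid T n (Suc k)}" for n k r
    proof (cases "grid T n k < S w")
      case True
      have "w (grid T n k) \<in> {b<..<N}" using before[of "grid T n k"] True g01[OF k] by auto
      hence "w (grid T n k) \<in> {b/2..N+1}" "r \<in> {0..T}" using ab r g01[OF k] by auto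
      hence "\<bar>Vt (w (grid T n k)) r\<bar> \<le> Bt" using Bt by blast
      thus ?thesis using True BL[OF g01(2)[OF k], of "w r"] by (simp add: q_def)
    qed (simp add: q_def)
    have meas_h: "set_borel_measurable lborel {0..T} h"
    proof -
      have "continuous_on {0..S w} (\<lambda>r. K (w r) r)"
      proof (rule continuous_on_compose2[OF cK', of _ "\<lambda>r. (w r, r)", simplified])
        show "continuous_on {0..S w} (\<lambda>r. (w r, r))"
          by (intro continuous_intros continuous_on_subset[OF wc]) auto
        show "(\<lambda>r. (w r, r)) ` {0..S w} \<subseteq> {0<..} \<times> {0..T}"
        proof clarsimp
          fix r assume "0 \<le> r" "r \<le> S w"
          thus "0 < w r \<and> r \<le> T" using before[of r] S ab by (cases "r = S w") auto
        qed
      qed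
      hence "set_integrable lborel {0..S w} (\<lambda>r. K (w r) r)"
        by (rule borel_integrable_atLeastAtMost')
      hence "set_integrable lborel {0..<S w} (\<lambda>r. K (w r) r)"
        by (rule set_integrable_subset) auto
      hence "(\<lambda>r. indicator {0..<S w} r *\<^sub>R K (w r) r) \<in> borel_measurable lborel"
        unfolding set_integrable_def by (rule borel_measurable_integrable)
      moreover have "(\<lambda>r. indicator {0..<S w} r *\<^sub>R K (w r) r) = (\<lambda>r. indicator {0..T} r *\<^sub>R h r)"
        using S by (auto simp: h_def indicator_def)
      ultimately show ?thesis by (simp add: set_borel_measurable_def)
    qed
    have lim_q: "(\<lambda>n. q w n (nat \<lfloor>r * real (Suc n) / T\<rfloor>) r) \<longlonglongrightarrow> h r"
      if r: "0 < r" "r < T" "r \<noteq> S w" for r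
    proof -
      define k where "k n = nat \<lfloor>r * real (Suc n) / T\<rfloor>" for n
      have k: "k n < Suc n" "grid T n (k n) \<le> r" for n
        using grid_floor(1,2)[of r T n] r by (auto simp: k_def simp del: of_nat_Suc)
      have kl: "(\<lambda>n. grid T n (k n)) \<longlonglongrightarrow> r" "(\<lambda>n. grid T n (Suc (k n))) \<longlonglongrightarrow> r"
        unfolding k_def using r by (intro grid_floor_tendsto; simp)+
      show ?thesis
      proof (cases "r < S w")
        case True
        have wr: "w r \<in> {b<..<N}" using before[of r] r True by auto
        have wr': "(w r, r) \<in> {0<..} \<times> {0..T}" using wr ab r by auto
        have wk: "(\<lambda>n. w (grid T n (k n))) \<longlonglongrightarrow> w r"
          by (rule w_lim[OF kl(1)]) (use g01[OF k(1)] r in auto)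
        have kS: "grid T n (k n) < S w" for n using k(2)[of n] True by simp
        have l1: "(\<lambda>n. L (w r) (grid T n (Suc (k n)))) \<longlonglongrightarrow> L (w r) r"
          using continuous_on_tendsto_compose[OF cL' tendsto_Pair[OF tendsto_const kl(2)] wr']
            wr' g01(2)[OF k(1)] by (auto intro: always_eventually)
        have "(w (grid T n (k n)), r) \<in> {0<..} \<times> {0..T}" for n
          using before[OF _ kS, of n] g01[OF k(1), of n] ab r by auto
        hence l2: "(\<lambda>n. Vt (w (grid T n (k n))) r) \<longlonglongrightarrow> Vt (w r) r"
          using continuous_on_tendsto_compose[OF cVt tendsto_Pair[OF wk tendsto_const] wr']
          by (auto intro: always_eventually)
        have "K (w r) r = L (w r) r + Vt (w r) r"
          using \<phi>(4)[of "w r"] wr by (auto simp: K_def L_def)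
        thus ?thesis unfolding k_def[symmetric] using tendsto_add[OF l1 l2] True kS
          by (simp add: q_def h_def)
      next
        case False
        hence "S w < r" using r by simp
        from order_tendstoD(1)[OF kl(1) this]
        have "\<forall>\<^sub>F n in sequentially. q w n (k n) r = 0"
          by eventually_elim (simp add: q_def)
        thus ?thesis using False by (simp add: h_def k_def tendsto_eventually)
      qed
    qed
    have lim: "(\<lambda>n. \<Sum>k<Suc n. LBINT r:{grid T n k..grid T n (Suc k)}. q w n k r) \<longlonglongrightarrow> (LBINT r:{0..T}. h r)"
      "\<bar>\<Sum>k<Suc n. LBINT r:{grid T n k..grid T n (Suc k)}. q w n k r\<bar> \<le> (\<bar>BL\<bar> + \<bar>Bt\<bar>) * T" for n
      by (rule grid_integral_tendsto[where h = h and S = "S w"]; fact T int_q bound_q meas_h lim_q)+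
    have "(LBINT r:{0..T}. h r) = (LBINT r:{0..S w}. K (w r) r)"
      unfolding set_lebesgue_integral_def
    proof (rule integral_cong_AE)
      show "AE r in lborel. indicator {0..T} r *\<^sub>R h r = indicator {0..S w} r *\<^sub>R K (w r) r"
        using AE_lborel_singleton[of "S w"] by eventually_elim (use S in \<open>auto simp: indicator_def h_def\<close>)
      show "(\<lambda>r. indicator {0..T} r *\<^sub>R h r) \<in> borel_measurable lborel"
        using meas_h by (simp add: set_borel_measurable_def)
      have "(\<lambda>r. indicator {0..T} r *\<^sub>R h r + indicator {S w} r *\<^sub>R K (w (S w)) (S w)) \<in> borel_measurable lborel"
        using meas_h by (auto simp: set_borel_measurable_def)
      also have "(\<lambda>r. indicator {0..T} r *\<^sub>R h r + indicator {S w} r *\<^sub>R K (w (S w)) (S w))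
          = (\<lambda>r. indicator {0..S w} r *\<^sub>R K (w r) r)"
        using S by (auto simp: h_def indicator_def fun_eq_iff)
      finally show "(\<lambda>r. indicator {0..S w} r *\<^sub>R K (w r) r) \<in> borel_measurable lborel" .
    qed
    with lim(1) show "(\<lambda>n. Xn n w - Zn n w) \<longlonglongrightarrow> (LBINT r:{0..S w}. K (w r) r)"
      by (simp only: Yn_eq)
    show "\<bar>Xn n w - Zn n w\<bar> \<le> (\<bar>BL\<bar> + \<bar>Bt\<bar>) * T"
      unfolding Yn_eq by (rule lim(2))
  qed

  \<comment> \<open>Passage to the limit in expectation\<close>
  define X' I where "X' w = indicator G w * (V (w (S w)) (S w) - V a 0)"
    and "I w = indicator G w * (LBINT r:{0..S w}. K (w r) r)" for w
  have off: "Xn n w = 0" "Zn n w = 0" "X' w = 0" "I w = 0" if "w \<notin> G" for w n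
    using that by (simp_all add: Xn_def Zn_def X'_def I_def)
  have lX: "(\<lambda>n. Xn n w) \<longlonglongrightarrow> X' w" for w
    using path(1)[of w] off by (cases "w \<in> G") (auto simp: X'_def)
  have bX: "\<bar>Xn n w\<bar> \<le> 2 * \<bar>Bf\<bar>" for n w
    using path(2)[of w n] off by (cases "w \<in> G") auto
  have lI: "(\<lambda>n. Xn n w - Zn n w) \<longlonglongrightarrow> I w" for w
    using path(3)[of w] off by (cases "w \<in> G") (auto simp: I_def)
  have bI: "\<bar>Xn n w - Zn n w\<bar> \<le> (\<bar>BL\<bar> + \<bar>Bt\<bar>) * T" for n w
    using path(4)[of w n] off T by (cases "w \<in> G") auto
  have mX: "X' \<in> borel_measurable P" by (rule borel_measurable_LIMSEQ_real[OF lX Xn_meas])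
  have mY: "(\<lambda>w. Xn n w - Zn n w) \<in> borel_measurable P" for n
    using Xn_meas Zn by (intro borel_measurable_diff) auto
  have mI: "I \<in> borel_measurable P" by (rule borel_measurable_LIMSEQ_real[OF lI mY])
  have c: "integrable P (\<lambda>_. 2 * \<bar>Bf\<bar>)" "integrable P (\<lambda>_. (\<bar>BL\<bar> + \<bar>Bt\<bar>) * T)" by auto
  have "AE w in P. (\<lambda>n. Xn n w) \<longlonglongrightarrow> X' w" "\<And>n. AE w in P. norm (Xn n w) \<le> 2 * \<bar>Bf\<bar>"
    using lX bX by auto
  note X_conv = mX Xn_meas c(1) this
  note dX = integrable_dominated_convergence[OF X_conv] integral_dominated_convergence[OF X_conv]
    integrable_dominated_convergence2[OF X_conv]
  have "AE w in P. (\<lambda>n. Xn n w - Zn n w) \<longlonglongrightarrow> I w"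
    "\<And>n. AE w in P. norm (Xn n w - Zn n w) \<le> (\<bar>BL\<bar> + \<bar>Bt\<bar>) * T"
    using lI bI by auto
  note I_conv = mI mY c(2) this
  note dI = integrable_dominated_convergence[OF I_conv] integral_dominated_convergence[OF I_conv]
  have "integral\<^sup>L P (\<lambda>w. Xn n w - Zn n w) = integral\<^sup>L P (Xn n)" for n
    using dX(3)[of n] Zn[of n] by simp
  with dI(2) have "(\<lambda>n. integral\<^sup>L P (Xn n)) \<longlonglongrightarrow> integral\<^sup>L P I" by simp
  \<comment> \<open>\<open>Zn\<close> has mean 0, so one and the same sequence of expectations
    converges to both integrals.\<close>
  hence eq: "integral\<^sup>L P X' = integral\<^sup>L P I" using dX(2) LIMSEQ_unique by blast
  show thesis
  proof (rule that[of "\<lambda>w. V a 0 + X' w" I])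
    show "integral\<^sup>L P (\<lambda>w. V a 0 + X' w) = V a 0 + integral\<^sup>L P I"
      using dX(1) eq by (simp add: prob_space)
    show "integrable P I" by (rule dI(1))
    show "integrable P (\<lambda>w. V a 0 + X' w)" using dX(1) by simp
  qed (auto simp: X'_def I_def G_def S_def K_def)
qed

subsection \<open>The Gamma distribution function and the Bessel heat equation\<close>

text \<open>The regularised lower incomplete Gamma function. For z < 0 the integral is over the
  empty set, so the value is 0.\<close>

definition gamma_cdf :: "real \<Rightarrow> real \<Rightarrow> real" where
  "gamma_cdf \<mu> z = integral {0..z} (\<lambda>s. s powr (\<mu> - 1) / exp s) / Gamma \<mu>"

lemma gamma_integrand_integrable:
  fixes \<mu> z :: real
  assumes "0 < \<mu>"
  shows "(\<lambda>s. s powr (\<mu> - 1) / exp s) integrable_on {0..z}"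
proof (rule integrable_on_subinterval)
  show "(\<lambda>s. s powr (\<mu> - 1) / exp s) integrable_on {0..}"
    using Gamma_integral_real[OF assms] by blast
qed auto

lemma gamma_cdf_has_derivative:
  assumes "0 < \<mu>" "0 < z"
  shows "(gamma_cdf \<mu> has_real_derivative z powr (\<mu> - 1) * exp (- z) / Gamma \<mu>) (at z)"
proof -
  let ?h = "\<lambda>s. s powr (\<mu> - 1) / exp s"
  have "continuous (at z within {0..z + 1}) ?h"
    using assms by (intro continuous_intros) auto
  from integral_has_vector_derivative_continuous_at[where S = "{}", simplified,
      OF gamma_integrand_integrable[OF assms(1)] _ this]
  have "((\<lambda>u. integral {0..u} ?h) has_vector_derivative ?h z) (at z within {0..z + 1})"
    using assms by simp
  hence "((\<lambda>u. integral {0..u} ?h) has_real_derivative ?h z) (at z within {0..z + 1})"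
    by (simp add: has_real_derivative_iff_has_vector_derivative)
  hence "((\<lambda>u. integral {0..u} ?h) has_real_derivative ?h z) (at z)"
    using assms by (subst (asm) at_within_interior) auto
  hence "((\<lambda>u. integral {0..u} ?h / Gamma \<mu>) has_real_derivative ?h z / Gamma \<mu>) (at z)"
    by (rule DERIV_cdivide)
  thus ?thesis by (simp add: gamma_cdf_def[abs_def] exp_minus field_simps)
qed

lemma gamma_cdf_mono:
  assumes "0 < \<mu>" "y \<le> z"
  shows "gamma_cdf \<mu> y \<le> gamma_cdf \<mu> z"
  unfolding gamma_cdf_def
proof (intro divide_right_mono integral_subset_le gamma_integrand_integrable assms)
  show "0 \<le> Gamma \<mu>" using Gamma_real_pos[OF assms(1)] by simp
qed (use assms in auto)

lemma gamma_cdf_nonneg: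
  assumes "0 < \<mu>"
  shows "0 \<le> gamma_cdf \<mu> z"
  unfolding gamma_cdf_def using Gamma_real_pos[OF assms]
  by (intro divide_nonneg_pos integral_nonneg gamma_integrand_integrable assms) auto

lemma gamma_cdf_le_1:
  assumes "0 < \<mu>"
  shows "gamma_cdf \<mu> z \<le> 1"
proof -
  have "integral {0..z} (\<lambda>s. s powr (\<mu> - 1) / exp s) \<le> integral {0..} (\<lambda>s. s powr (\<mu> - 1) / exp s)"
    using Gamma_integral_real[OF assms]
    by (intro integral_subset_le gamma_integrand_integrable assms) auto
  also have "\<dots> = Gamma \<mu>" using Gamma_integral_real[OF assms] by (rule integral_unique)
  finally show ?thesis
    using Gamma_real_pos[OF assms] by (simp add: gamma_cdf_def field_simps)
qed

text \<open>Integrate \<open>1 - z \<le> exp (- s) \<le> 1\<close>, valid for s between 0 and z,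
  against \<open>s powr (\<mu> - 1)\<close>. This identifies the leading term with relative error at
  most \<open>z\<close>.\<close>

lemma gamma_cdf_bounds:
  assumes "0 < \<mu>" "0 \<le> z"
  shows "gamma_cdf \<mu> z \<le> z powr \<mu> / Gamma (1 + \<mu>)"
    and "(1 - z) * z powr \<mu> / Gamma (1 + \<mu>) \<le> gamma_cdf \<mu> z"
proof -
  have G: "Gamma (1 + \<mu>) = \<mu> * Gamma \<mu>" "0 < Gamma \<mu>"
    using Gamma_plus1[of \<mu>] Gamma_real_pos[OF assms(1)] assms nonpos_Ints_nonpos[of \<mu>]
    by (auto simp: add.commute)
  have p: "((\<lambda>s. s powr (\<mu> - 1)) has_integral z powr \<mu> / \<mu>) {0..z}"
    using has_integral_powr_from_0[of "\<mu> - 1" z] assms by simp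
  have "integral {0..z} (\<lambda>s. s powr (\<mu> - 1) / exp s) \<le> z powr \<mu> / \<mu>"
  proof (rule has_integral_le[OF integrable_integral[OF gamma_integrand_integrable[OF assms(1)]] p])
    fix s assume "s \<in> {0..z}"
    hence "1 \<le> exp s" by simp
    thus "s powr (\<mu> - 1) / exp s \<le> s powr (\<mu> - 1)"
      by (simp add: divide_le_eq mult_le_cancel_left1)
  qed
  thus "gamma_cdf \<mu> z \<le> z powr \<mu> / Gamma (1 + \<mu>)"
    using G assms by (simp add: gamma_cdf_def field_simps)
  have "(1 - z) * (z powr \<mu> / \<mu>) \<le> integral {0..z} (\<lambda>s. s powr (\<mu> - 1) / exp s)"
  proof (rule has_integral_le[OF has_integral_mult_right[OF p]
        integrable_integral[OF gamma_integrand_integrable[OF assms(1)]]])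
    fix s assume "s \<in> {0..z}"
    hence "1 - z \<le> exp (- s)" using exp_ge_add_one_self[of "- s"] by auto
    hence "(1 - z) * s powr (\<mu> - 1) \<le> exp (- s) * s powr (\<mu> - 1)"
      by (rule mult_right_mono) simp
    thus "(1 - z) * s powr (\<mu> - 1) \<le> s powr (\<mu> - 1) / exp s"
      by (simp add: exp_minus field_simps)
  qed
  hence "(1 - z) * (z powr \<mu> / \<mu>) / Gamma \<mu> \<le> gamma_cdf \<mu> z"
    unfolding gamma_cdf_def using G by (intro divide_right_mono) auto
  thus "(1 - z) * z powr \<mu> / Gamma (1 + \<mu>) \<le> gamma_cdf \<mu> z"
    using G by simp
qed

lemma gamma_cdf_tendsto_1:
  assumes "0 < \<mu>"
  shows "(\<lambda>n. gamma_cdf \<mu> (real n)) \<longlonglongrightarrow> 1"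
proof -
  let ?h = "\<lambda>s::real. s powr (\<mu> - 1) / exp s"
  have int: "?h integrable_on {0..}" using Gamma_integral_real[OF assms] by blast
  have "(\<lambda>n. integral {0..} (\<lambda>s. if s \<in> {0..real n} then ?h s else 0)) \<longlonglongrightarrow> integral {0..} ?h"
  proof (rule dominated_convergence(2)[OF _ int])
    show "(\<lambda>s. if s \<in> {0..real n} then ?h s else 0) integrable_on {0..}" for n
      using gamma_integrand_integrable[OF assms, of "real n"]
      by (subst integrable_restrict_Int) (simp add: Int_absorb2 Int_commute)
    show "(\<lambda>n. if s \<in> {0..real n} then ?h s else 0) \<longlonglongrightarrow> ?h s" if "s \<in> {0..}" for s
    proof (rule tendsto_eventually)
      obtain m :: nat where "s \<le> real m" using real_arch_simple by blast
      thus "\<forall>\<^sub>F n in sequentially. (if s \<in> {0..real n} then ?h s else 0) = ?h s"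
        using that unfolding eventually_sequentially
        by (intro exI[of _ m]) (auto intro: order_trans)
    qed
  qed auto
  moreover have "integral {0..} (\<lambda>s. if s \<in> {0..real n} then ?h s else 0) = integral {0..real n} ?h" for n
    by (subst integral_restrict_Int) (simp add: Int_absorb1)
  moreover have "integral {0..} ?h = Gamma \<mu>"
    using Gamma_integral_real[OF assms] by (rule integral_unique)
  ultimately have "(\<lambda>n. integral {0..real n} ?h / Gamma \<mu>) \<longlonglongrightarrow> Gamma \<mu> / Gamma \<mu>"
    using Gamma_real_pos[OF assms] by (intro tendsto_intros) auto
  thus ?thesis using Gamma_real_pos[OF assms] by (simp add: gamma_cdf_def)
qed

text \<open>The Gamma density at \<open>x\<^sup>2 / (2 * s)\<close>. It is the common factor of all
  derivatives of \<open>u\<close>.\<close>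

definition gamma_heat :: "real \<Rightarrow> real \<Rightarrow> real \<Rightarrow> real" where
  "gamma_heat \<mu> x s = (x\<^sup>2 / (2 * s)) powr (\<mu> - 1) * exp (- (x\<^sup>2 / (2 * s))) / Gamma \<mu>"

text \<open>These formulas contain the heat equation: for index -\<mu> the generator sends the
  function of the first claim to
  \<open>- gamma_heat \<mu> x s * x\<^sup>2 / (2 * s\<^sup>2)\<close>, which cancels the third
  derivative when \<open>s = c - t\<close>.\<close>

lemma gamma_heat_derivatives:
  assumes \<mu>: "0 < \<mu>" and x: "0 < x"
  shows "0 < s \<Longrightarrow> ((\<lambda>x. gamma_cdf \<mu> (x\<^sup>2 / (2 * s))) has_real_derivative gamma_heat \<mu> x s * x / s) (at x)"
    and "0 < s \<Longrightarrow> ((\<lambda>x. gamma_heat \<mu> x s) has_real_derivative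
        gamma_heat \<mu> x s * ((2 * \<mu> - 2) / x - x / s)) (at x)"
    and "t < c \<Longrightarrow> ((\<lambda>t. gamma_cdf \<mu> (x\<^sup>2 / (2 * (c - t)))) has_real_derivative
        gamma_heat \<mu> x (c - t) * x\<^sup>2 / (2 * (c - t)\<^sup>2)) (at t)"
proof -
  show "((\<lambda>x. gamma_cdf \<mu> (x\<^sup>2 / (2 * s))) has_real_derivative gamma_heat \<mu> x s * x / s) (at x)"
    if s: "0 < s"
  proof -
    have 1: "((\<lambda>x. x\<^sup>2 / (2 * s)) has_real_derivative x / s) (at x)"
      using s by (auto intro!: derivative_eq_intros simp: field_simps)
    have "0 < x\<^sup>2 / (2 * s)" using s x by simp
    from DERIV_chain2[OF gamma_cdf_has_derivative[OF \<mu> this] 1]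
    show ?thesis by (simp add: gamma_heat_def field_simps)
  qed
  show "((\<lambda>t. gamma_cdf \<mu> (x\<^sup>2 / (2 * (c - t)))) has_real_derivative
        gamma_heat \<mu> x (c - t) * x\<^sup>2 / (2 * (c - t)\<^sup>2)) (at t)" if t: "t < c"
  proof -
    have 1: "((\<lambda>t. x\<^sup>2 / (2 * (c - t))) has_real_derivative x\<^sup>2 / (2 * (c - t)\<^sup>2)) (at t)"
    proof -
      have "((\<lambda>t. x\<^sup>2 / 2 * inverse (c - t)) has_real_derivative x\<^sup>2 / 2 * (inverse (c - t) * inverse (c - t))) (at t)"
        using t by (auto intro!: derivative_eq_intros)
      moreover have "(\<lambda>t. x\<^sup>2 / 2 * inverse (c - t)) = (\<lambda>t. x\<^sup>2 / (2 * (c - t)))"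
        by (simp add: fun_eq_iff inverse_eq_divide)
      moreover have "x\<^sup>2 / 2 * (inverse (c - t) * inverse (c - t)) = x\<^sup>2 / (2 * (c - t)\<^sup>2)"
        by (simp add: inverse_eq_divide power2_eq_square[of "c - t"])
      ultimately show ?thesis by (simp only:)
    qed
    have "0 < x\<^sup>2 / (2 * (c - t))" using t x by simp
    from DERIV_chain2[OF gamma_cdf_has_derivative[OF \<mu> this] 1]
    show ?thesis by (simp add: gamma_heat_def field_simps)
  qed
  show "((\<lambda>x. gamma_heat \<mu> x s) has_real_derivative
        gamma_heat \<mu> x s * ((2 * \<mu> - 2) / x - x / s)) (at x)" if s: "0 < s"
  proof -
    define z where "z = x\<^sup>2 / (2 * s)"
    have z: "0 < z" using s x by (simp add: z_def)
    have 1: "((\<lambda>x. x\<^sup>2 / (2 * s)) has_real_derivative x / s) (at x)"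
      using s by (auto intro!: derivative_eq_intros simp: field_simps)
    have 2: "((\<lambda>z. z powr (\<mu> - 1)) has_real_derivative (\<mu> - 1) * (z powr (\<mu> - 1) / z)) (at z)"
    proof -
      have "z powr (\<mu> - 1 - 1) = z powr (\<mu> - 1) / z"
        using z by (subst powr_diff) simp
      thus ?thesis using has_real_derivative_powr[OF z, of "\<mu> - 1"] by simp
    qed
    have 3: "((\<lambda>z. exp (- z)) has_real_derivative - exp (- z)) (at z)"
      by (auto intro!: derivative_eq_intros)
    have "((\<lambda>z. z powr (\<mu> - 1) * exp (- z) / Gamma \<mu>) has_real_derivative
        (((\<mu> - 1) * (z powr (\<mu> - 1) / z)) * exp (- z) + (- exp (- z)) * z powr (\<mu> - 1)) / Gamma \<mu>) (at z)"
      by (intro DERIV_cdivide DERIV_mult 2 3)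
    from DERIV_chain2[OF this[unfolded z_def] 1]
    have "((\<lambda>x. gamma_heat \<mu> x s) has_real_derivative
       (((\<mu> - 1) * (z powr (\<mu> - 1) / z)) * exp (- z) + (- exp (- z)) * z powr (\<mu> - 1)) / Gamma \<mu> * (x / s)) (at x)"
      by (simp only: gamma_heat_def z_def)
    hence "((\<lambda>x. gamma_heat \<mu> x s) has_real_derivative
        gamma_heat \<mu> x s * ((\<mu> - 1) * ((x / s) / z) - x / s)) (at x)"
    proof (rule DERIV_cong)
      show "(((\<mu> - 1) * (z powr (\<mu> - 1) / z)) * exp (- z) + (- exp (- z)) * z powr (\<mu> - 1)) / Gamma \<mu> * (x / s)
      = gamma_heat \<mu> x s * ((\<mu> - 1) * ((x / s) / z) - x / s)"
      unfolding gamma_heat_def z_def[symmetric] by (simp add: divide_inverse algebra_simps)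
    qed
    also have "(x / s) / z = 2 / x"
      using s x by (simp add: z_def field_simps power2_eq_square)
    finally show ?thesis by (simp add: algebra_simps)
  qed
qed

lemma gamma_heat_continuous:
  assumes "0 < \<mu>" "T < c"
  shows "continuous_on ({0<..} \<times> {0..T}) (\<lambda>p. gamma_heat \<mu> (fst p) (c - snd p))"
    and "continuous_on ({0<..} \<times> {0..T}) (\<lambda>p. gamma_cdf \<mu> ((fst p)\<^sup>2 / (2 * (c - snd p))))"
proof -
  show "continuous_on ({0<..} \<times> {0..T}) (\<lambda>p. gamma_heat \<mu> (fst p) (c - snd p))"
    unfolding gamma_heat_def using assms less_imp_neq[OF Gamma_real_pos[OF assms(1)], symmetric]
    by (intro continuous_intros) auto
  have "continuous_on {0<..} (gamma_cdf \<mu>)"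
    using gamma_cdf_has_derivative[OF assms(1)]
    by (intro continuous_at_imp_continuous_on) (auto intro: DERIV_isCont)
  moreover have "continuous_on ({0<..} \<times> {0..T}) (\<lambda>p::real \<times> real. (fst p)\<^sup>2 / (2 * (c - snd p)))"
    using assms by (intro continuous_intros) auto
  ultimately show "continuous_on ({0<..} \<times> {0..T}) (\<lambda>p. gamma_cdf \<mu> ((fst p)\<^sup>2 / (2 * (c - snd p))))"
    by (rule continuous_on_compose2) (use assms in auto)
qed

text \<open>Serves both bounds: \<open>\<beta> = 0\<close> gives \<open>u\<close> with zero drift,
  and \<open>\<beta> = b powr (2 * \<mu>)\<close> gives \<open>v\<close>. The condition
  \<open>T < c\<close> keeps the remaining time \<open>c - t\<close> positive on
  \<open>{0..T}\<close>.\<close>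

lemma bessel_exit_identity:
  fixes \<mu> a b N T c \<beta> :: real
  assumes law: "bessel_law (- \<mu>) a P" and \<mu>: "0 < \<mu>"
    and ab: "0 < b" "b < a" "a < N" and T: "0 < T" "T < c"
  defines "V \<equiv> \<lambda>x t. gamma_cdf \<mu> (x\<^sup>2 / (2 * (c - t))) * (1 - \<beta> * x powr (- 2 * \<mu>))"
  obtains X I where "integrable P X" "integrable P I" "integral\<^sup>L P X = V a 0 + integral\<^sup>L P I"
    "\<And>w. w \<in> space P \<Longrightarrow> w 0 = a \<Longrightarrow> X w = V (w (exit_time b N T w)) (exit_time b N T w)"
    "\<And>w. w \<in> space P \<Longrightarrow> w 0 = a \<Longrightarrow> I w = (LBINT r:{0..exit_time b N T w}.
        2 * \<mu> * \<beta> * w r powr (- 2 * \<mu>) * (gamma_heat \<mu> (w r) (c - r) / (c - r)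
          - 2 * \<mu> * gamma_cdf \<mu> ((w r)\<^sup>2 / (2 * (c - r))) / (w r)\<^sup>2))"
proof -
  define p where "p = (\<lambda>x::real. x powr (- 2 * \<mu>))"
  have p: "(p has_real_derivative - 2 * \<mu> * p x / x) (at x)" if "0 < x" for x
    using has_real_derivative_powr[OF that, of "- 2 * \<mu>"] that
    by (simp add: p_def powr_diff)
  have cp: "continuous_on ({0<..} \<times> {0..T}) (\<lambda>q. p (fst q))"
    unfolding p_def by (intro continuous_intros) auto
  define H where "H = (\<lambda>x t. gamma_cdf \<mu> (x\<^sup>2 / (2 * (c - t))))"
  define g where "g = (\<lambda>x t. gamma_heat \<mu> x (c - t))"
  have H: "((\<lambda>x. H x t) has_real_derivative g x t * x / (c - t)) (at x)"
      "((\<lambda>x. g x t) has_real_derivative g x t * ((2 * \<mu> - 2) / x - x / (c - t))) (at x)"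
      "(H x has_real_derivative g x t * x\<^sup>2 / (2 * (c - t)\<^sup>2)) (at t)"
    if "0 < x" "t \<in> {0..T}" for x t
    unfolding H_def g_def
    using gamma_heat_derivatives(1,2)[OF \<mu> that(1), of "c - t"]
      gamma_heat_derivatives(3)[OF \<mu> that(1), of t c] that(2) T by auto
  have cg: "continuous_on ({0<..} \<times> {0..T}) (\<lambda>q. g (fst q) (snd q))"
    and cH: "continuous_on ({0<..} \<times> {0..T}) (\<lambda>q. H (fst q) (snd q))"
    unfolding H_def g_def by (rule gamma_heat_continuous[OF \<mu> T(2)])+
  have V: "V = (\<lambda>x t. H x t * (1 - \<beta> * p x))" by (simp add: V_def H_def p_def)
  define Vx where "Vx = (\<lambda>x t. g x t * x / (c - t) * (1 - \<beta> * p x) + H x t * (2 * \<mu> * \<beta> * p x / x))"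
  define Vxx where "Vxx = (\<lambda>x t. g x t * ((2 * \<mu> - 1) / (c - t) - x\<^sup>2 / (c - t)\<^sup>2) * (1 - \<beta> * p x)
      + 2 * (g x t * x / (c - t)) * (2 * \<mu> * \<beta> * p x / x)
      + H x t * (- 2 * \<mu> * (2 * \<mu> + 1) * \<beta> * p x / x\<^sup>2))"
  define Vt where "Vt = (\<lambda>x t. g x t * x\<^sup>2 / (2 * (c - t)\<^sup>2) * (1 - \<beta> * p x))"
  have "((\<lambda>x. V x t) has_real_derivative Vx x t) (at x)" if "0 < x" "t \<in> {0..T}" for x t
    unfolding V Vx_def
    by (rule DERIV_cong, (rule derivative_intros H[OF that] p[OF that(1)])+) (simp add: field_simps)
  moreover have "((\<lambda>x. Vx x t) has_real_derivative Vxx x t) (at x)" if x: "0 < x" and t: "t \<in> {0..T}" for x t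
  proof -
    have s: "c - t \<noteq> 0" "x \<noteq> 0" using t T x by auto
    show ?thesis
      unfolding Vx_def Vxx_def
      by (rule DERIV_cong, (rule derivative_intros H[OF x t] p[OF x] s)+)
        (use s in \<open>simp add: divide_simps power2_eq_square\<close>, use s in \<open>simp add: algebra_simps\<close>)
  qed
  moreover have "(V x has_real_derivative Vt x t) (at t)" if "0 < x" "t \<in> {0..T}" for x t
    unfolding V Vt_def
    by (rule DERIV_cong, (rule derivative_intros H[OF that])+) (simp add: field_simps)
  moreover have "continuous_on ({0<..} \<times> {0..T}) (\<lambda>p. V (fst p) (snd p))"
    unfolding V by (intro continuous_intros cH cp)
  moreover have "continuous_on ({0<..} \<times> {0..T}) (\<lambda>p. Vx (fst p) (snd p))"
    unfolding Vx_def using T by (intro continuous_intros cH cp cg) auto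
  moreover have "continuous_on ({0<..} \<times> {0..T}) (\<lambda>p. Vxx (fst p) (snd p))"
    unfolding Vxx_def using T by (intro continuous_intros cH cp cg) auto
  moreover have "continuous_on ({0<..} \<times> {0..T}) (\<lambda>p. Vt (fst p) (snd p))"
    unfolding Vt_def using T by (intro continuous_intros cH cp cg) auto
  ultimately obtain X I where XI: "integrable P X" "integrable P I" "integral\<^sup>L P X = V a 0 + integral\<^sup>L P I"
    "\<And>w. w \<in> space P \<Longrightarrow> w 0 = a \<Longrightarrow> X w = V (w (exit_time b N T w)) (exit_time b N T w)"
    "\<And>w. w \<in> space P \<Longrightarrow> w 0 = a \<Longrightarrow> I w = (LBINT r:{0..exit_time b N T w}.
        1/2 * Vxx (w r) r + (2 * (- \<mu>) + 1) / (2 * w r) * Vx (w r) r + Vt (w r) r)"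
    by (rule dynkin_exit[OF law ab T(1)]) blast+
  \<comment> \<open>The terms without \<beta> cancel by the heat equation. There remain the cross
    term of the first derivatives of \<open>H\<close> and \<open>p\<close>, and \<open>H\<close>
    times the generator of \<open>p\<close>, which is
    \<open>4 * \<mu>\<^sup>2 * p x / x\<^sup>2\<close>.\<close>
  have K: "1/2 * Vxx x r + (2 * (- \<mu>) + 1) / (2 * x) * Vx x r + Vt x r
    = 2 * \<mu> * \<beta> * p x * (g x r / (c - r) - 2 * \<mu> * H x r / x\<^sup>2)" if "0 < x" "r < c" for x r
  proof -
    have s: "c - r \<noteq> 0" "x \<noteq> 0" using that by auto
    show ?thesis unfolding Vx_def Vxx_def Vt_def
      using s by (simp add: divide_simps power2_eq_square) (simp add: algebra_simps)
  qed
  show thesis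
  proof (rule that[OF XI(1-4)])
    fix w assume w: "w \<in> space P" "w 0 = a"
    have wc: "continuous_on {0..} w"
      using law w(1) sets_eq_imp_space_eq[of P path_space]
      by (auto simp: bessel_law_def intro: continuous_on_path_space)
    have wcT: "continuous_on {0..T} w" by (rule continuous_on_subset[OF wc]) auto
    have S: "exit_time b N T w \<le> T" "w (exit_time b N T w) \<ge> b"
      using exit_time_value[OF wcT T(1), of b N] exit_time_nonneg_le[of T b N w] T w ab by auto
    have "0 < w r \<and> r < c" if "r \<in> {0..exit_time b N T w}" for r
      using exit_time_before[of r b N T w] that S T ab by (cases "r = exit_time b N T w") auto
    note pos = this
    have "I w = (LBINT r:{0..exit_time b N T w}.
        2 * \<mu> * \<beta> * p (w r) * (g (w r) r / (c - r) - 2 * \<mu> * H (w r) r / (w r)\<^sup>2))"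
      unfolding XI(5)[OF w] by (intro set_lebesgue_integral_cong allI impI K) (use pos in auto)
    thus "I w = (LBINT r:{0..exit_time b N T w}.
        2 * \<mu> * \<beta> * w r powr (- 2 * \<mu>) * (gamma_heat \<mu> (w r) (c - r) / (c - r)
          - 2 * \<mu> * gamma_cdf \<mu> ((w r)\<^sup>2 / (2 * (c - r))) / (w r)\<^sup>2))"
      by (simp add: p_def g_def H_def)
  qed
qed

text \<open>For small \<open>z = x\<^sup>2 / (2 * s)\<close> both terms in the bracket have the
  leading part \<open>z powr (\<mu> - 1) / (Gamma \<mu> * s)\<close>, which cancels; the bounds on
  \<open>exp\<close> and on \<open>gamma_cdf\<close> leave at least
  \<open>- z powr \<mu> / (Gamma \<mu> * s)\<close>. The factor \<open>x powr (- 2 * \<mu>)\<close>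
  then removes the position, so the bound is uniform in \<open>x\<close>.\<close>

lemma bessel_exit_drift_bound:
  fixes \<mu> x s \<beta> :: real
  assumes "0 < \<mu>" "0 < x" "0 < s" "0 \<le> \<beta>"
  shows "- (2 * \<mu> * \<beta> * 2 powr (- \<mu>) / Gamma \<mu>) * s powr (- \<mu> - 1)
    \<le> 2 * \<mu> * \<beta> * x powr (- 2 * \<mu>) * (gamma_heat \<mu> x s / s - 2 * \<mu> * gamma_cdf \<mu> (x\<^sup>2 / (2 * s)) / x\<^sup>2)"
proof -
  define z where "z = x\<^sup>2 / (2 * s)"
  have z: "0 < z" using assms by (simp add: z_def)
  have G: "Gamma (1 + \<mu>) = \<mu> * Gamma \<mu>" "0 < Gamma \<mu>"
    using Gamma_plus1[of \<mu>] Gamma_real_pos[OF assms(1)] assms nonpos_Ints_nonpos[of \<mu>]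
    by (auto simp: add.commute)
  have zp: "z powr \<mu> = z * z powr (\<mu> - 1)" using z by (simp add: powr_diff)
  have "gamma_heat \<mu> x s \<ge> z powr (\<mu> - 1) * (1 - z) / Gamma \<mu>"
    unfolding gamma_heat_def z_def[symmetric] using G exp_ge_add_one_self[of "- z"]
    by (intro divide_right_mono mult_left_mono) auto
  hence 1: "gamma_heat \<mu> x s / s \<ge> z powr (\<mu> - 1) * (1 - z) / Gamma \<mu> / s"
    using assms by (intro divide_right_mono) auto
  have "2 * \<mu> * gamma_cdf \<mu> z / x\<^sup>2 \<le> 2 * \<mu> * (z powr \<mu> / Gamma (1 + \<mu>)) / x\<^sup>2"
    using gamma_cdf_bounds(1)[OF assms(1), of z] z assms by (intro divide_right_mono mult_left_mono) auto
  also have "\<dots> = z powr (\<mu> - 1) / Gamma \<mu> * (2 * z / x\<^sup>2)"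
    using assms G by (simp add: zp)
  also have "2 * z / x\<^sup>2 = 1 / s" using assms by (simp add: z_def)
  finally have "gamma_heat \<mu> x s / s - 2 * \<mu> * gamma_cdf \<mu> z / x\<^sup>2
      \<ge> z powr (\<mu> - 1) * (1 - z) / Gamma \<mu> / s - z powr (\<mu> - 1) / Gamma \<mu> * (1 / s)"
    using 1 by linarith
  also have "z powr (\<mu> - 1) * (1 - z) / Gamma \<mu> / s - z powr (\<mu> - 1) / Gamma \<mu> * (1 / s)
      = - (z powr \<mu> / (Gamma \<mu> * s))"
    by (simp add: zp algebra_simps diff_divide_distrib)
  finally have "2 * \<mu> * \<beta> * x powr (- 2 * \<mu>) * - (z powr \<mu> / (Gamma \<mu> * s))
      \<le> 2 * \<mu> * \<beta> * x powr (- 2 * \<mu>) * (gamma_heat \<mu> x s / s - 2 * \<mu> * gamma_cdf \<mu> z / x\<^sup>2)"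
    using assms by (intro mult_left_mono) auto
  moreover have "x powr (- 2 * \<mu>) * z powr \<mu> = 2 powr (- \<mu>) * s powr (- \<mu>)"
  proof -
    have "z powr \<mu> = (x powr 2) powr \<mu> / (2 powr \<mu> * s powr \<mu>)"
      using assms by (simp add: z_def powr_divide powr_mult powr_numeral)
    also have "(x powr 2) powr \<mu> = x powr (2 * \<mu>)" by (simp add: powr_powr)
    finally show ?thesis using assms by (simp add: powr_minus field_simps)
  qed
  hence "2 * \<mu> * \<beta> * x powr (- 2 * \<mu>) * - (z powr \<mu> / (Gamma \<mu> * s))
      = - (2 * \<mu> * \<beta> * 2 powr (- \<mu>) / Gamma \<mu>) * (s powr (- \<mu>) / s)"
    by (simp add: field_simps)
  moreover have "s powr (- \<mu>) / s = s powr (- \<mu> - 1)" using assms by (simp add: powr_diff)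
  ultimately show ?thesis by (simp add: z_def)
qed

subsection \<open>Bounds for the survival probability\<close>

text \<open>By connectedness a path avoiding \<open>b\<close> stays on one side of it, and by
  compactness it is bounded; so the event is a countable union of events of staying in an open
  interval.\<close>

lemma sets_avoids:
  fixes b s t :: real
  assumes X: "\<And>r. r \<in> {s..t} \<Longrightarrow> (\<lambda>w. w r) \<in> borel_measurable M"
    and cont: "\<And>w. w \<in> space M \<Longrightarrow> continuous_on {s..t} w"
  shows "{w \<in> space M. \<forall>r\<in>{s..t}. w r \<noteq> b} \<in> sets M"
proof -
  let ?U = "\<Union>n::nat. {w \<in> space M. \<forall>r\<in>{s..t}. b < w r \<and> w r < real n}"
  let ?L = "\<Union>n::nat. {w \<in> space M. \<forall>r\<in>{s..t}. - real n < w r \<and> w r < b}"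
  have "{w \<in> space M. \<forall>r\<in>{s..t}. w r \<noteq> b} \<subseteq> ?U \<union> ?L"
  proof
    fix w assume w: "w \<in> {w \<in> space M. \<forall>r\<in>{s..t}. w r \<noteq> b}"
    have c: "continuous_on {s..t} w" using w cont by auto
    have "bounded (w ` {s..t})"
      by (intro compact_imp_bounded compact_continuous_image c compact_Icc)
    then obtain B where B: "\<And>r. r \<in> {s..t} \<Longrightarrow> \<bar>w r\<bar> \<le> B" unfolding bounded_iff by (auto simp del: atLeastAtMost_iff)
    obtain n :: nat where n: "B < real n" using reals_Archimedean2 by blast
    have "connected (w ` {s..t})" by (intro connected_continuous_image c connected_Icc)
    from connectedD_interval[OF this] have "\<not> (w r \<le> b \<and> b \<le> w r')" if "r \<in> {s..t}" "r' \<in> {s..t}" for r r'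
      using w that by blast
    hence "(\<forall>r\<in>{s..t}. b < w r) \<or> (\<forall>r\<in>{s..t}. w r < b)" by (meson not_le)
    moreover have "- real n < w r \<and> w r < real n" if "r \<in> {s..t}" for r
      using B[OF that] n by auto
    ultimately show "w \<in> ?U \<union> ?L" using w by blast
  qed
  hence "{w \<in> space M. \<forall>r\<in>{s..t}. w r \<noteq> b} = ?U \<union> ?L" by fastforce
  also have "\<dots> \<in> sets M"
    by (intro sets.Un sets.countable_UN image_subsetI sets_stays_in_interval X cont)
  finally show ?thesis .
qed

text \<open>The hitting time ignores time 0, and \<open>{0<..t}\<close> is not compact; it is
  exhausted by the intervals starting at \<open>1/(n+1)\<close>.\<close>

lemma sets_hitting_time_greater:
  assumes "sets P = sets path_space" "0 < t"
  shows "{w \<in> space P. hitting_time b w > ereal t} \<in> sets P"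
proof -
  have sp: "space P = space path_space" by (rule sets_eq_imp_space_eq) fact
  have "{w \<in> space P. hitting_time b w > ereal t}
      = {w \<in> space P. \<forall>s\<in>{0<..t}. w s \<noteq> b}"
    using hitting_time_greater_iff[OF continuous_on_path_space assms(2)] sp by auto
  also have "\<dots> = (\<Inter>n::nat. {w \<in> space P. \<forall>s\<in>{inverse (real (Suc n))..t}. w s \<noteq> b})"
  proof (intro equalityI subsetI)
    fix w assume "w \<in> {w \<in> space P. \<forall>s\<in>{0<..t}. w s \<noteq> b}"
    hence "w \<in> space P" "w s \<noteq> b" if "s \<in> {inverse (real (Suc n))..t}" for s n
      using that less_le_trans[of 0 "inverse (real (Suc n))" s] by (auto simp del: of_nat_Suc)
    with \<open>w \<in> _\<close> show "w \<in> (\<Inter>n::nat. {w \<in> space P. \<forall>s\<in>{inverse (real (Suc n))..t}. w s \<noteq> b})"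
      by blast
  next
    fix w assume w: "w \<in> (\<Inter>n::nat. {w \<in> space P. \<forall>s\<in>{inverse (real (Suc n))..t}. w s \<noteq> b})"
    have "w s \<noteq> b" if s: "s \<in> {0<..t}" for s
    proof -
      have "0 < s" using s by simp
      then obtain n where "inverse (real (Suc n)) < s" using reals_Archimedean by blast
      hence "s \<in> {inverse (real (Suc n))..t}" using s by simp
      thus ?thesis using w by blast
    qed
    thus "w \<in> {w \<in> space P. \<forall>s\<in>{0<..t}. w s \<noteq> b}" using w by auto
  qed
  also have "\<dots> \<in> sets P"
  proof (intro sets.countable_INT image_subsetI sets_avoids)
    fix n :: nat
    have pos: "0 \<le> r" if "inverse (real (Suc n)) \<le> r" for r
      by (rule order.trans[OF _ that]) simp
    show "(\<lambda>w. w r) \<in> borel_measurable P" if "r \<in> {inverse (real (Suc n))..t}" for r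
      by (rule coordinate_measurable_path_space[OF assms(1)]) (use pos[of r] that in simp)
    show "continuous_on {inverse (real (Suc n))..t} w" if "w \<in> space P" for w
      by (rule continuous_on_subset[OF continuous_on_path_space])
        (use pos that sp in \<open>auto simp del: of_nat_Suc\<close>)
  qed auto
  finally show ?thesis .
qed

text \<open>The intermediate value theorem; the starting point above \<open>b\<close> supplies the
  condition at time 0, which the hitting time does not see.\<close>

lemma hitting_time_greater_iff_above:
  assumes w: "continuous_on {0..} w" and "b < w 0" "0 < t"
  shows "hitting_time b w > ereal t \<longleftrightarrow> (\<forall>s\<in>{0..t}. b < w s)"
  unfolding hitting_time_greater_iff[OF w assms(3)]
proof
  assume *: "\<forall>s\<in>{0<..t}. w s \<noteq> b"
  show "\<forall>s\<in>{0..t}. b < w s"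
  proof (intro ballI, rule ccontr)
    fix s assume s: "s \<in> {0..t}" "\<not> b < w s"
    have "connected (w ` {0..s})"
      by (intro connected_continuous_image connected_Icc continuous_on_subset[OF w]) auto
    from connectedD_interval[OF this, of "w s" "w 0" b] s assms
    obtain r where "r \<in> {0..s}" "w r = b" by auto
    thus False using * assms s by (cases "r = 0") auto
  qed
qed auto

text \<open>Removes the barrier: every path is bounded on \<open>{0..T}\<close>, so the events
  increase to the whole survival event, respectively to the whole space. The lower end
  \<open>B\<close> may depend on \<open>n\<close> to cover both cases, and the summand 1 puts the
  barrier strictly above \<open>a\<close>.\<close>

lemma stay_probability_tendsto:
  fixes a b T :: real
  assumes law: "bessel_law \<nu> a P"
  defines "E \<equiv> \<lambda>B n. {w \<in> space P. \<forall>s\<in>{0..T}. B n < w s \<and> w s < a + 1 + real n}"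
  shows "E B n \<in> sets P"
    and "0 < T \<Longrightarrow> b < a \<Longrightarrow>
      (\<lambda>n. measure P (E (\<lambda>_. b) n)) \<longlonglongrightarrow> \<P>(w in P. hitting_time b w > ereal T)"
    and "(\<lambda>n. measure P (E (\<lambda>n. - (a + 1 + real n)) n)) \<longlonglongrightarrow> 1"
proof -
  have prob: "prob_space P" and sets_P: "sets P = sets path_space" and start: "AE w in P. w 0 = a"
    using law by (auto simp: bessel_law_def)
  interpret prob_space P by (rule prob)
  have sp: "space P = space path_space" by (rule sets_eq_imp_space_eq) fact
  have wc: "continuous_on {0..T} w" if "w \<in> space P" for w
    by (rule continuous_on_subset[OF continuous_on_path_space]) (use that sp in auto)
  show E: "E B n \<in> sets P" for B n
    unfolding E_def
    by (intro sets_stays_in_interval wc coordinate_measurable_path_space[OF sets_P]) auto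
  have bdd: "\<exists>n::nat. \<forall>s\<in>{0..T}. \<bar>w s\<bar> < a + 1 + real n" if "w \<in> space P" for w
  proof -
    have "bounded (w ` {0..T})"
      by (intro compact_imp_bounded compact_continuous_image wc that compact_Icc)
    then obtain B where B: "\<And>r. r \<in> {0..T} \<Longrightarrow> \<bar>w r\<bar> \<le> B" unfolding bounded_iff by (auto simp del: atLeastAtMost_iff)
    obtain n :: nat where "B - (a + 1) < real n" using reals_Archimedean2 by blast
    thus ?thesis using B by (intro exI[of _ n]) force
  qed
  show "(\<lambda>n. measure P (E (\<lambda>n. - (a + 1 + real n)) n)) \<longlonglongrightarrow> 1"
  proof -
    have "(\<lambda>n. measure P (E (\<lambda>n. - (a + 1 + real n)) n))
        \<longlonglongrightarrow> measure P (\<Union>n. E (\<lambda>n. - (a + 1 + real n)) n)"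
    proof (rule finite_Lim_measure_incseq)
      show "range (\<lambda>n. E (\<lambda>n. - (a + 1 + real n)) n) \<subseteq> sets P" using E by auto
      show "incseq (\<lambda>n. E (\<lambda>n. - (a + 1 + real n)) n)"
        by (rule incseq_SucI) (force simp: E_def)
    qed
    also have "(\<Union>n. E (\<lambda>n. - (a + 1 + real n)) n) = space P"
    proof (intro equalityI subsetI)
      fix w assume w: "w \<in> space P"
      then obtain n where "\<forall>s\<in>{0..T}. \<bar>w s\<bar> < a + 1 + real n" using bdd by blast
      hence "- (a + 1 + real n) < w s \<and> w s < a + 1 + real n" if "s \<in> {0..T}" for s
        using that by (metis abs_less_iff minus_less_iff)
      thus "w \<in> (\<Union>n. E (\<lambda>n. - (a + 1 + real n)) n)" using w by (simp only: E_def) blast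
    qed (auto simp: E_def)
    finally show ?thesis by (simp add: prob_space)
  qed
  show "(\<lambda>n. measure P (E (\<lambda>_. b) n)) \<longlonglongrightarrow> \<P>(w in P. hitting_time b w > ereal T)"
    if T: "0 < T" "b < a"
  proof -
    have "(\<lambda>n. measure P (E (\<lambda>_. b) n)) \<longlonglongrightarrow> measure P (\<Union>n. E (\<lambda>_. b) n)"
    proof (rule finite_Lim_measure_incseq)
      show "range (\<lambda>n. E (\<lambda>_. b) n) \<subseteq> sets P" using E by auto
      show "incseq (\<lambda>n. E (\<lambda>_. b) n)"
        by (rule incseq_SucI) (force simp: E_def)
    qed
    also have "measure P (\<Union>n. E (\<lambda>_. b) n) = measure P {w \<in> space P. hitting_time b w > ereal T}"
    proof (rule measure_eq_AE)
      show "AE w in P. (w \<in> (\<Union>n. E (\<lambda>_. b) n)) = (w \<in> {w \<in> space P. hitting_time b w > ereal T})"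
        using start AE_space
      proof eventually_elim
        case (elim w)
        have "(\<exists>n. w \<in> E (\<lambda>_. b) n) \<longleftrightarrow> (\<forall>s\<in>{0..T}. b < w s)"
        proof
          assume *: "\<forall>s\<in>{0..T}. b < w s"
          obtain n where "\<forall>s\<in>{0..T}. \<bar>w s\<bar> < a + 1 + real n" using bdd elim(2) by blast
          hence "w s < a + 1 + real n" if "s \<in> {0..T}" for s
            using that by (metis abs_less_iff)
          thus "\<exists>n. w \<in> E (\<lambda>_. b) n" using * elim(2) by (simp only: E_def) blast
        qed (auto simp: E_def)
        thus ?case
          using hitting_time_greater_iff_above[OF continuous_on_path_space, of w b T] elim T sp by simp
      qed
      show "(\<Union>n. E (\<lambda>_. b) n) \<in> sets P" using E by blast
    qed (rule sets_hitting_time_greater[OF sets_P T(1)])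
    finally show ?thesis .
  qed
qed

lemma exit_time_path:
  assumes law: "bessel_law \<nu> a P" and w: "w \<in> space P" "w 0 = a"
    and ab: "0 < b" "b < a" "a < N" and T: "0 < T"
  shows "continuous_on {0..} w" "0 < exit_time b N T w" "exit_time b N T w \<le> T"
    "w (exit_time b N T w) \<in> {b..N}"
    "(\<forall>s\<in>{0..T}. b < w s \<and> w s < N) \<and> exit_time b N T w = T
      \<or> w (exit_time b N T w) = b \<or> w (exit_time b N T w) = N"
proof -
  have "space P = space path_space" using law sets_eq_imp_space_eq by (auto simp: bessel_law_def)
  thus wc: "continuous_on {0..} w" using w by (auto intro: continuous_on_path_space)
  have wcT: "continuous_on {0..T} w" by (rule continuous_on_subset[OF wc]) auto
  show "exit_time b N T w \<le> T" using exit_time_nonneg_le T by auto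
  show "0 < exit_time b N T w" "w (exit_time b N T w) \<in> {b..N}"
    "(\<forall>s\<in>{0..T}. b < w s \<and> w s < N) \<and> exit_time b N T w = T
      \<or> w (exit_time b N T w) = b \<or> w (exit_time b N T w) = N"
    using exit_time_value[OF wcT T, of b N] w ab by auto
qed

text \<open>A path that stays in the interval ends at time \<open>T\<close> with only
  \<open>s\<close> on the clock, where \<open>u\<close> is at least
  \<open>H (b\<^sup>2 / (2 * s))\<close>; any other path stops at a position at least
  \<open>b\<close> with at most \<open>T + s\<close> on the clock. Letting the barrier tend to
  infinity and then \<open>s\<close> to 0 raises the first value to 1.\<close>

lemma survival_upper_bound:
  assumes law: "bessel_law (- \<mu>) a P" and \<mu>: "0 < \<mu>" and ab: "0 < b" "b < a" and T: "0 < T"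
  defines "q \<equiv> \<P>(w in P. hitting_time b w > ereal T)"
  shows "q + (1 - q) * gamma_cdf \<mu> (b\<^sup>2 / (2 * T)) \<le> gamma_cdf \<mu> (a\<^sup>2 / (2 * T))"
proof -
  have prob: "prob_space P" and start: "AE w in P. w 0 = a"
    using law by (auto simp: bessel_law_def)
  interpret prob_space P by (rule prob)
  define H where "H = gamma_cdf \<mu>"
  define E where "E n = {w \<in> space P. \<forall>s\<in>{0..T}. b < w s \<and> w s < a + 1 + real n}" for n :: nat
  have E: "E n \<in> sets P" for n
    unfolding E_def using stay_probability_tendsto(1)[OF law, where B = "\<lambda>_. b"] .
  have E_lim: "(\<lambda>n. measure P (E n)) \<longlonglongrightarrow> q"
    unfolding E_def q_def using stay_probability_tendsto(2)[OF law T ab(2)] .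
  have fin: "measure P (E n) * H (b\<^sup>2 / (2 * s)) + (1 - measure P (E n)) * H (b\<^sup>2 / (2 * (T + s)))
      \<le> H (a\<^sup>2 / (2 * (T + s)))" if s: "0 < s" for s n
  proof -
    let ?N = "a + 1 + real n"
    let ?S = "exit_time b ?N T"
    have N: "a < ?N" by simp
    have c: "T < T + s" using s by simp
    obtain X I where XI: "integrable P X" "integrable P I"
      "integral\<^sup>L P X = H (a\<^sup>2 / (2 * (T + s - 0))) * (1 - 0 * a powr (- 2 * \<mu>)) + integral\<^sup>L P I"
      "\<And>w. w \<in> space P \<Longrightarrow> w 0 = a \<Longrightarrow>
        X w = H ((w (?S w))\<^sup>2 / (2 * (T + s - ?S w))) * (1 - 0 * w (?S w) powr (- 2 * \<mu>))"
      "\<And>w. w \<in> space P \<Longrightarrow> w 0 = a \<Longrightarrow> I w = (LBINT r:{0..?S w}.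
        2 * \<mu> * 0 * w r powr (- 2 * \<mu>) * (gamma_heat \<mu> (w r) (T + s - r) / (T + s - r)
          - 2 * \<mu> * gamma_cdf \<mu> ((w r)\<^sup>2 / (2 * (T + s - r))) / (w r)\<^sup>2))"
      unfolding H_def by (rule bessel_exit_identity[OF law \<mu> ab N T c, where \<beta> = 0]) blast
    have "AE w in P. I w = 0"
      using start AE_space by eventually_elim (simp add: XI(5) set_lebesgue_integral_def)
    hence "integral\<^sup>L P I = 0" by (rule integral_eq_zero_AE)
    hence X: "integral\<^sup>L P X = H (a\<^sup>2 / (2 * (T + s)))" using XI(3) by simp
    \<comment> \<open>The lower bound for \<open>X\<close> just described, with \<open>E n\<close>
      separating the two kinds of paths.\<close>
    define Y where "Y w = indicator (E n) w * H (b\<^sup>2 / (2 * s))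
      + (1 - indicator (E n) w) * H (b\<^sup>2 / (2 * (T + s)))" for w
    have Y_int: "integrable P Y" unfolding Y_def using E
      by (intro Bochner_Integration.integrable_add integrable_mult_left
          Bochner_Integration.integrable_diff integrable_real_indicator) (auto simp: emeasure_eq_measure)
    have "integral\<^sup>L P Y \<le> integral\<^sup>L P X"
    proof (rule integral_mono_AE[OF Y_int XI(1)])
      show "AE w in P. Y w \<le> X w"
        using start AE_space
      proof eventually_elim
        case (elim w)
        note S = exit_time_path[OF law elim(2,1) ab N T]
        have X_eq: "X w = H ((w (?S w))\<^sup>2 / (2 * (T + s - ?S w)))" using XI(4) elim by simp
        have sq: "b\<^sup>2 \<le> (w (?S w))\<^sup>2" using S(4) ab by (intro power_mono) auto
        show ?case
        proof (cases "w \<in> E n")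
          case True
          moreover have "?S w \<in> {0..T}" using S(2,3) by auto
          ultimately have "b < w (?S w) \<and> w (?S w) < ?N" by (auto simp: E_def simp del: atLeastAtMost_iff)
          hence "?S w = T" using S(5) by auto
          hence "b\<^sup>2 / (2 * s) \<le> (w (?S w))\<^sup>2 / (2 * (T + s - ?S w))"
            using sq s by (simp add: divide_right_mono)
          hence "H (b\<^sup>2 / (2 * s)) \<le> X w" unfolding X_eq H_def by (rule gamma_cdf_mono[OF \<mu>])
          thus ?thesis using True by (simp add: Y_def)
        next
          case False
          have "b\<^sup>2 / (2 * (T + s)) \<le> (w (?S w))\<^sup>2 / (2 * (T + s - ?S w))"
            using sq s S T by (intro frac_le) auto
          hence "H (b\<^sup>2 / (2 * (T + s))) \<le> X w" unfolding X_eq H_def by (rule gamma_cdf_mono[OF \<mu>])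
          thus ?thesis using False by (simp add: Y_def)
        qed
      qed
    qed
    moreover have "integral\<^sup>L P Y = measure P (E n) * H (b\<^sup>2 / (2 * s))
        + (1 - measure P (E n)) * H (b\<^sup>2 / (2 * (T + s)))"
      unfolding Y_def using E by (simp add: emeasure_eq_measure prob_space)
    ultimately show ?thesis using X by simp
  qed
  have lim_s: "q * H (b\<^sup>2 / (2 * s)) + (1 - q) * H (b\<^sup>2 / (2 * (T + s))) \<le> H (a\<^sup>2 / (2 * (T + s)))"
    if s: "0 < s" for s
    by (rule LIMSEQ_le_const2[OF tendsto_add[OF tendsto_mult[OF E_lim tendsto_const]
        tendsto_mult[OF tendsto_diff[OF tendsto_const E_lim] tendsto_const]]]) (use fin[OF s] in auto)
  \<comment> \<open>Chosen so that the argument of \<open>H\<close> on survivors is exactly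
    \<open>n + 1\<close>, where the limit 1 is known.\<close>
  define s where "s n = b\<^sup>2 / (2 * real (Suc n))" for n
  have s: "0 < s n" "b\<^sup>2 / (2 * s n) = real (Suc n)" for n using ab by (simp_all add: s_def)
  have s_lim: "s \<longlonglongrightarrow> 0"
    using grid_step_tendsto_0[of "b\<^sup>2 / 2"] by (simp add: s_def[abs_def] field_simps del: of_nat_Suc)
  have H_lim: "(\<lambda>n. H (x\<^sup>2 / (2 * (T + s n)))) \<longlonglongrightarrow> H (x\<^sup>2 / (2 * T))" if "0 < x" for x
  proof (rule isCont_tendsto_compose[where g = H])
    show "isCont H (x\<^sup>2 / (2 * T))"
      unfolding H_def using that T by (intro DERIV_isCont[OF gamma_cdf_has_derivative[OF \<mu>]]) simp
    have "(\<lambda>n. x\<^sup>2 / (2 * (T + s n))) \<longlonglongrightarrow> x\<^sup>2 / (2 * (T + 0))"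
      using T by (intro tendsto_intros s_lim) auto
    thus "(\<lambda>n. x\<^sup>2 / (2 * (T + s n))) \<longlonglongrightarrow> x\<^sup>2 / (2 * T)" by simp
  qed
  have "(\<lambda>n. q * H (b\<^sup>2 / (2 * s n)) + (1 - q) * H (b\<^sup>2 / (2 * (T + s n))))
      \<longlonglongrightarrow> q * 1 + (1 - q) * H (b\<^sup>2 / (2 * T))"
    unfolding s(2) using LIMSEQ_Suc[OF gamma_cdf_tendsto_1[OF \<mu>]]
    by (intro tendsto_intros H_lim ab(1)) (simp_all only: H_def)
  moreover have "(\<lambda>n. H (a\<^sup>2 / (2 * (T + s n)))) \<longlonglongrightarrow> H (a\<^sup>2 / (2 * T))"
    using ab by (intro H_lim) simp
  ultimately have "q * 1 + (1 - q) * H (b\<^sup>2 / (2 * T)) \<le> H (a\<^sup>2 / (2 * T))"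
    by (rule LIMSEQ_le) (use lim_s[OF s(1)] in auto)
  thus ?thesis by (simp add: H_def)
qed

text \<open>Three regimes for the duration \<open>S\<close>. Up to \<open>s\<close> the integrand is
  at most \<open>T powr (- \<mu> - 1)\<close>; up to \<open>T / 2\<close> it is at most
  \<open>(T / 2) powr (- \<mu> - 1)\<close>; beyond that the exact antiderivative is used. The
  conditions are kept because in expectation they become the small probabilities of surviving to
  \<open>s\<close> and to \<open>T / 2\<close>.\<close>

lemma drift_integral_bound:
  fixes \<mu> s T S :: real
  assumes "0 < \<mu>" "0 < s" "0 < S" "S \<le> T"
  shows "set_integrable lborel {0..S} (\<lambda>r. (T + s - r) powr (- \<mu> - 1))"
    and "(LBINT r:{0..S}. (T + s - r) powr (- \<mu> - 1))
      \<le> s * T powr (- \<mu> - 1) + (if s < S then (T / 2) powr (- \<mu>) else 0)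
        + (if T / 2 < S then s powr (- \<mu>) / \<mu> else 0)"
proof -
  let ?f = "\<lambda>r. (T + s - r) powr (- \<mu> - 1)"
  have c: "continuous_on {0..S} ?f" using assms by (intro continuous_intros) auto
  thus int: "set_integrable lborel {0..S} ?f" by (rule borel_integrable_atLeastAtMost')
  have const: "(LBINT r:{0..S}. ?f r) \<le> S * M" if "\<And>r. r \<in> {0..S} \<Longrightarrow> ?f r \<le> M" for M
  proof -
    have "(LBINT r:{0..S}. ?f r) \<le> (LBINT r:{0..S}. M)"
      using that by (intro set_integral_mono int borel_integrable_atLeastAtMost' continuous_intros) auto
    also have "\<dots> = S * M" using assms by (simp add: set_lebesgue_integral_def)
    finally show ?thesis .
  qed
  show "(LBINT r:{0..S}. ?f r) \<le> s * T powr (- \<mu> - 1) + (if s < S then (T / 2) powr (- \<mu>) else 0)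
        + (if T / 2 < S then s powr (- \<mu>) / \<mu> else 0)"
  proof (cases "S \<le> s")
    case True
    have "(LBINT r:{0..S}. ?f r) \<le> S * T powr (- \<mu> - 1)"
      using assms True by (intro const powr_mono2') auto
    also have "\<dots> \<le> s * T powr (- \<mu> - 1)" using True by (intro mult_right_mono) auto
    finally show ?thesis using assms True by (smt (verit) divide_nonneg_pos powr_ge_zero)
  next
    case s: False
    show ?thesis
    proof (cases "S \<le> T / 2")
      case True
      have "(LBINT r:{0..S}. ?f r) \<le> S * (T / 2) powr (- \<mu> - 1)"
        using assms True by (intro const powr_mono2') auto
      also have "\<dots> \<le> T / 2 * (T / 2) powr (- \<mu> - 1)" using True by (intro mult_right_mono) auto
      also have "\<dots> = (T / 2) powr (- \<mu>)" using assms by (simp add: powr_diff)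
      finally have "(LBINT r:{0..S}. ?f r) \<le> (T / 2) powr (- \<mu>)" .
      moreover have "0 \<le> s * T powr (- \<mu> - 1)" using assms by simp
      ultimately show ?thesis using s True by simp
    next
      case False
      have "((\<lambda>r. (T + s - r) powr (- \<mu>) / \<mu>) has_real_derivative ?f r) (at r within {0..S})"
        if "0 \<le> r" "r \<le> S" for r
      proof -
        have "0 < T + s - r" using that assms by simp
        hence "((\<lambda>r. (T + s - r) powr (- \<mu>)) has_real_derivative \<mu> * ?f r) (at r within {0..S})"
        proof -
          assume pos: "0 < T + s - r"
          have "((\<lambda>r. T + s - r) has_real_derivative - 1) (at r within {0..S})"
            by (auto intro!: derivative_eq_intros)
          from DERIV_chain2[OF has_real_derivative_powr[OF pos, of "- \<mu>"] this]
          show ?thesis by simp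
        qed
        from DERIV_cdivide[OF this, of \<mu>] show ?thesis using assms by simp
      qed
      hence "(LBINT r:{0..S}. ?f r) = (T + s - S) powr (- \<mu>) / \<mu> - (T + s - 0) powr (- \<mu>) / \<mu>"
        unfolding set_lebesgue_integral_def using assms
        by (intro integral_FTC_atLeastAtMost c)
          (auto simp: has_real_derivative_iff_has_vector_derivative)
      also have "\<dots> \<le> (T + s - S) powr (- \<mu>) / \<mu>" using assms by simp
      also have "\<dots> \<le> s powr (- \<mu>) / \<mu>"
        using assms by (intro divide_right_mono powr_mono2') auto
      finally show ?thesis using s False assms by (smt (verit) mult_nonneg_nonneg powr_ge_zero)
    qed
  qed
qed

text \<open>\<open>C\<close> is the constant of \<open>bessel_exit_drift_bound\<close> for
  \<open>\<beta> = b powr (2 * \<mu>)\<close>. The factors \<open>q s\<close> and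
  \<open>q (T / 2)\<close> arise because the larger parts of the drift integral are paid only by
  paths that survive that long.\<close>

lemma survival_lower_bound:
  assumes law: "bessel_law (- \<mu>) a P" and \<mu>: "0 < \<mu>" and ab: "0 < b" "b < a"
    and T: "0 < T" and s: "0 < s"
  defines "q \<equiv> \<lambda>t. \<P>(w in P. hitting_time b w > ereal t)"
    and "C \<equiv> 2 * \<mu> * b powr (2 * \<mu>) * 2 powr (- \<mu>) / Gamma \<mu>"
  shows "gamma_cdf \<mu> (a\<^sup>2 / (2 * (T + s))) * (1 - (b / a) powr (2 * \<mu>))
    \<le> q T + C * (s * T powr (- \<mu> - 1) + q s * (T / 2) powr (- \<mu>) + q (T / 2) * (s powr (- \<mu>) / \<mu>))"
proof -
  have prob: "prob_space P" and sets_P: "sets P = sets path_space" and start: "AE w in P. w 0 = a"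
    using law by (auto simp: bessel_law_def)
  interpret prob_space P by (rule prob)
  have C: "0 \<le> C" unfolding C_def using \<mu> Gamma_real_pos[OF \<mu>] by simp
  define \<beta> where "\<beta> = b powr (2 * \<mu>)"
  have \<beta>: "0 \<le> \<beta>" by (simp add: \<beta>_def)
  have \<beta>_eq: "\<beta> * x powr (- 2 * \<mu>) = (b / x) powr (2 * \<mu>)" if "0 < x" for x
    using that ab by (simp add: \<beta>_def powr_divide powr_minus_divide)
  \<comment> \<open>The symmetric interval makes \<open>E n\<close> nearly certain even for paths
    that fall below \<open>b\<close>; its complement accounts for every path stopped at the upper
    barrier.\<close>
  define E where "E n = {w \<in> space P. \<forall>s\<in>{0..T}. - (a + 1 + real n) < w s \<and> w s < a + 1 + real n}" for n :: nat
  have E: "E n \<in> sets P" for n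
    unfolding E_def using stay_probability_tendsto(1)[OF law, where B = "\<lambda>n. - (a + 1 + real n)"] .
  have E_lim: "(\<lambda>n. measure P (E n)) \<longlonglongrightarrow> 1"
    unfolding E_def using stay_probability_tendsto(3)[OF law] .
  define Q where "Q t = {w \<in> space P. hitting_time b w > ereal t}" for t
  have Q: "Q t \<in> sets P" if "0 < t" for t
    unfolding Q_def by (rule sets_hitting_time_greater[OF sets_P that])
  \<comment> \<open>A pathwise majorant of the drift integral, with the conditions on the exit time
    relaxed to survival events.\<close>
  define R where "R w = s * T powr (- \<mu> - 1) + indicator (Q s) w * (T / 2) powr (- \<mu>)
      + indicator (Q (T / 2)) w * (s powr (- \<mu>) / \<mu>)" for w
  have R_int: "integrable P R"
    unfolding R_def using Q s T
    by (intro Bochner_Integration.integrable_add integrable_mult_left integrable_real_indicator)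
      (auto simp: emeasure_eq_measure)
  have R_eq: "integral\<^sup>L P R = s * T powr (- \<mu> - 1) + q s * (T / 2) powr (- \<mu>) + q (T / 2) * (s powr (- \<mu>) / \<mu>)"
    unfolding R_def q_def Q_def[symmetric] using Q s T by (simp add: emeasure_eq_measure prob_space)
  have fin: "gamma_cdf \<mu> (a\<^sup>2 / (2 * (T + s))) * (1 - (b / a) powr (2 * \<mu>))
      \<le> q T + (1 - measure P (E n)) + C * integral\<^sup>L P R" for n
  proof -
    let ?N = "a + 1 + real n"
    let ?S = "exit_time b ?N T"
    have N: "a < ?N" by simp
    have c: "T < T + s" using s by simp
    obtain X I where XI: "integrable P X" "integrable P I"
      "integral\<^sup>L P X = gamma_cdf \<mu> (a\<^sup>2 / (2 * (T + s - 0))) * (1 - \<beta> * a powr (- 2 * \<mu>)) + integral\<^sup>L P I"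
      "\<And>w. w \<in> space P \<Longrightarrow> w 0 = a \<Longrightarrow>
        X w = gamma_cdf \<mu> ((w (?S w))\<^sup>2 / (2 * (T + s - ?S w))) * (1 - \<beta> * w (?S w) powr (- 2 * \<mu>))"
      "\<And>w. w \<in> space P \<Longrightarrow> w 0 = a \<Longrightarrow> I w = (LBINT r:{0..?S w}.
        2 * \<mu> * \<beta> * w r powr (- 2 * \<mu>) * (gamma_heat \<mu> (w r) (T + s - r) / (T + s - r)
          - 2 * \<mu> * gamma_cdf \<mu> ((w r)\<^sup>2 / (2 * (T + s - r))) / (w r)\<^sup>2))"
      by (rule bessel_exit_identity[OF law \<mu> ab N T c, where \<beta> = \<beta>]) blast
    have above: "w \<in> Q t" if w: "w \<in> space P" "w 0 = a" and t: "0 < t" "\<And>r. r \<in> {0..t} \<Longrightarrow> b < w r" for w t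
      unfolding Q_def
      using hitting_time_greater_iff_above[OF exit_time_path(1)[OF law w ab N T], of b t] w t ab by auto
    \<comment> \<open>Paths stopped at \<open>b\<close> contribute 0, since the factor of
      \<open>v\<close> vanishes there. Otherwise only \<open>X w \<le> 1\<close> is used, charged to
      survival or to having touched the barrier.\<close>
    have X_le: "X w \<le> indicator (Q T) w + (1 - indicator (E n) w)" if w: "w \<in> space P" "w 0 = a" for w
    proof -
      note S = exit_time_path[OF law w ab N T]
      let ?x = "w (?S w)"
      have x: "0 < ?x" "b \<le> ?x" using S(4) ab by auto
      have "b / ?x \<le> 1" using x by simp
      hence "(b / ?x) powr (2 * \<mu>) \<le> 1" using ab x \<mu> by (intro powr_le1) auto
      hence f: "0 \<le> 1 - \<beta> * ?x powr (- 2 * \<mu>)" "1 - \<beta> * ?x powr (- 2 * \<mu>) \<le> 1"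
        using \<beta>_eq[OF x(1)] \<beta> by auto
      have X1: "X w \<le> 1"
        unfolding XI(4)[OF w] using mult_mono[OF gamma_cdf_le_1[OF \<mu>] f(2) _ f(1)] by simp
      from S(5) show ?thesis
      proof (elim disjE)
        assume "(\<forall>s\<in>{0..T}. b < w s \<and> w s < ?N) \<and> ?S w = T"
        hence "w \<in> Q T" using T by (intro above w) auto
        thus ?thesis using X1 by (auto simp: indicator_def)
      next
        assume "?x = b"
        hence "X w = 0" unfolding XI(4)[OF w] using \<beta>_eq[OF x(1)] ab by simp
        thus ?thesis by (auto simp: indicator_def)
      next
        assume "?x = ?N"
        moreover have "?S w \<in> {0..T}" using S(2,3) by auto
        ultimately have "w \<notin> E n" unfolding E_def by (metis (mono_tags, lifting) less_irrefl mem_Collect_eq)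
        thus ?thesis using X1 by (auto simp: indicator_def)
      qed
    qed
    have I_ge: "- C * R w \<le> I w" if w: "w \<in> space P" "w 0 = a" for w
    proof -
      note S = exit_time_path[OF law w ab N T]
      define K where "K r = 2 * \<mu> * \<beta> * w r powr (- 2 * \<mu>) * (gamma_heat \<mu> (w r) (T + s - r) / (T + s - r)
          - 2 * \<mu> * gamma_cdf \<mu> ((w r)\<^sup>2 / (2 * (T + s - r))) / (w r)\<^sup>2)" for r
      have pos: "0 < w r" if "r \<in> {0..?S w}" for r
        using exit_time_before[of r b ?N T w] that S(4) T ab by (cases "r = ?S w") auto
      have before: "w \<in> Q t" if "0 < t" "t < ?S w" for t
        using exit_time_before(1)[of _ b ?N T w] that T by (intro above w) auto
      note J = drift_integral_bound[OF \<mu> s S(2,3)]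
      have int_K: "set_integrable lborel {0..?S w} K"
      proof (rule borel_integrable_atLeastAtMost')
        have path: "continuous_on {0..?S w} (\<lambda>r. (w r, r))"
          by (intro continuous_intros continuous_on_subset[OF S(1)]) auto
        have sub: "(\<lambda>r. (w r, r)) ` {0..?S w} \<subseteq> {0<..} \<times> {0..T}"
          using pos S(3) by auto
        have "continuous_on ({0<..} \<times> {0..T}) (\<lambda>p. 2 * \<mu> * \<beta> * fst p powr (- 2 * \<mu>) *
            (gamma_heat \<mu> (fst p) (T + s - snd p) / (T + s - snd p)
              - 2 * \<mu> * gamma_cdf \<mu> ((fst p)\<^sup>2 / (2 * (T + s - snd p))) / (fst p)\<^sup>2))"
          using s by (intro continuous_intros gamma_heat_continuous[OF \<mu> c]) auto
        from continuous_on_compose2[OF this path sub]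
        show "continuous_on {0..?S w} K" by (simp add: K_def[abs_def])
      qed
      have "(LBINT r:{0..?S w}. - C * (T + s - r) powr (- \<mu> - 1)) \<le> (LBINT r:{0..?S w}. K r)"
      proof (rule set_integral_mono[OF set_integrable_mult_right[OF J(1)] int_K])
        fix r assume r: "r \<in> {0..?S w}"
        have "0 < T + s - r" using r S(3) s by auto
        from bessel_exit_drift_bound[OF \<mu> pos[OF r] this \<beta>]
        show "- C * (T + s - r) powr (- \<mu> - 1) \<le> K r"
          unfolding K_def C_def \<beta>_def .
      qed
      moreover have "(LBINT r:{0..?S w}. - C * (T + s - r) powr (- \<mu> - 1))
          = - C * (LBINT r:{0..?S w}. (T + s - r) powr (- \<mu> - 1))"
        by (rule set_integral_mult_right)
      moreover have "(LBINT r:{0..?S w}. (T + s - r) powr (- \<mu> - 1)) \<le> R w"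
      proof (rule order.trans[OF J(2)])
        have "(if s < ?S w then (T / 2) powr (- \<mu>) else 0) \<le> indicator (Q s) w * (T / 2) powr (- \<mu>)"
          using before[OF s] by auto
        moreover have "(if T / 2 < ?S w then s powr (- \<mu>) / \<mu> else 0) \<le> indicator (Q (T / 2)) w * (s powr (- \<mu>) / \<mu>)"
          using before[of "T / 2"] T \<mu> by auto
        ultimately show "s * T powr (- \<mu> - 1) + (if s < ?S w then (T / 2) powr (- \<mu>) else 0)
            + (if T / 2 < ?S w then s powr (- \<mu>) / \<mu> else 0) \<le> R w"
          unfolding R_def by linarith
      qed
      hence "C * (LBINT r:{0..?S w}. (T + s - r) powr (- \<mu> - 1)) \<le> C * R w"
        using C by (rule mult_left_mono)
      ultimately show ?thesis unfolding XI(5)[OF w] K_def by simp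
    qed
    have "integral\<^sup>L P X \<le> (\<integral>w. indicator (Q T) w + (1 - indicator (E n) w) \<partial>P)"
      using Q[OF T] E[of n] start AE_space X_le
      by (intro integral_mono_AE XI Bochner_Integration.integrable_add
          Bochner_Integration.integrable_diff integrable_real_indicator) (auto simp: emeasure_eq_measure)
    also have "\<dots> = q T + (1 - measure P (E n))"
      using Q[OF T] E[of n] by (simp add: emeasure_eq_measure prob_space q_def Q_def)
    finally have "integral\<^sup>L P X \<le> q T + (1 - measure P (E n))" .
    moreover have "(\<integral>w. - C * R w \<partial>P) \<le> integral\<^sup>L P I"
      using start AE_space I_ge R_int by (intro integral_mono_AE XI integrable_mult_right) auto
    hence "- C * integral\<^sup>L P R \<le> integral\<^sup>L P I" by simp
    ultimately show ?thesis using XI(3) \<beta>_eq[of a] ab by simp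
  qed
  have "(\<lambda>n. q T + (1 - measure P (E n)) + C * integral\<^sup>L P R) \<longlonglongrightarrow> q T + (1 - 1) + C * integral\<^sup>L P R"
    by (intro tendsto_intros E_lim)
  hence "gamma_cdf \<mu> (a\<^sup>2 / (2 * (T + s))) * (1 - (b / a) powr (2 * \<mu>)) \<le> q T + (1 - 1) + C * integral\<^sup>L P R"
    by (rule LIMSEQ_le_const) (use fin in auto)
  thus ?thesis by (simp add: R_eq)
qed

subsection \<open>Asymptotics\<close>

text \<open>The three orders have different sources: \<open>D1\<close> from expanding the Gamma
  distribution function, \<open>D2\<close> from the product of two crude bounds in the upper
  estimate, \<open>D3\<close> from the shift \<open>s\<close> in the lower one.\<close>

lemma survival_asymptotics:
  assumes law: "bessel_law (- \<mu>) a P" and \<mu>: "0 < \<mu>" and ab: "0 < b" "b < a"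
  defines "q \<equiv> \<lambda>t. \<P>(w in P. hitting_time b w > ereal t)"
    and "A \<equiv> \<lambda>t. a powr (2 * \<mu>) * (1 - (b / a) powr (2 * \<mu>)) * (1 / (Gamma (1 + \<mu>) * (2 * t) powr \<mu>))"
  obtains D1 D2 D3 where "\<And>t. 1 \<le> t \<Longrightarrow> a\<^sup>2 \<le> t \<Longrightarrow>
    \<bar>q t - A t\<bar> \<le> D1 * t powr (- \<mu> - 1) + D2 * t powr (- 2 * \<mu>) + D3 * t powr (- \<mu> - \<mu> / (1 + \<mu>))"
    "0 \<le> D1" "0 \<le> D2" "0 \<le> D3"
proof -
  define m where "m = Gamma (1 + \<mu>)"
  have m: "0 < m" unfolding m_def using \<mu> by (intro Gamma_real_pos) simp
  \<comment> \<open>\<open>k x * t powr (- \<mu>)\<close> is the leading term of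
    \<open>gamma_cdf \<mu> (x\<^sup>2 / (2 * t))\<close>.\<close>
  define k where "k x = x powr (2 * \<mu>) / (m * 2 powr \<mu>)" for x
  have k: "0 \<le> k x" for x using m by (simp add: k_def)
  define F where "F = 1 - (b / a) powr (2 * \<mu>)"
  have F: "0 \<le> F" "F \<le> 1"
    unfolding F_def using powr_le1[of "2 * \<mu>" "b / a"] ab \<mu> by auto
  define C where "C = 2 * \<mu> * b powr (2 * \<mu>) * 2 powr (- \<mu>) / Gamma \<mu>"
  have C: "0 \<le> C" unfolding C_def using \<mu> Gamma_real_pos[OF \<mu>] by simp
  have W: "(x\<^sup>2 / (2 * t)) powr \<mu> / m = k x * t powr (- \<mu>)" if "0 < x" "0 < t" for x t
  proof -
    have "(x\<^sup>2 / (2 * t)) powr \<mu> = (x powr 2) powr \<mu> / (2 powr \<mu> * t powr \<mu>)"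
      using that by (simp add: powr_divide powr_mult powr_numeral)
    also have "(x powr 2) powr \<mu> = x powr (2 * \<mu>)" by (simp add: powr_powr)
    finally show ?thesis using that by (simp add: k_def powr_minus_divide)
  qed
  have A_eq: "A t = F * (k a * t powr (- \<mu>))" if "0 < t" for t
    using that by (simp add: A_def F_def k_def m_def powr_mult powr_minus_divide mult_ac)
  \<comment> \<open>The two estimates produce the leading coefficient in different shapes, a
    difference above and a product below; here they are seen to agree.\<close>
  have kb: "k a - k b = F * k a"
  proof -
    have "k b = (b / a) powr (2 * \<mu>) * k a"
      using ab by (simp add: k_def powr_divide)
    thus ?thesis by (simp add: F_def algebra_simps)
  qed
  \<comment> \<open>The crude bound comes first: it controls the product \<open>q t * v\<close> here
    and the survival probabilities in the error of the lower bound.\<close>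
  have crude: "q t \<le> k a * t powr (- \<mu>)" and
    fine: "q t - A t \<le> b\<^sup>2 / 2 * k b * t powr (- \<mu> - 1) + k a * k b * t powr (- 2 * \<mu>)" if t: "0 < t" for t
  proof -
    define u v where "u = gamma_cdf \<mu> (a\<^sup>2 / (2 * t))" and "v = gamma_cdf \<mu> (b\<^sup>2 / (2 * t))"
    have main: "q t + (1 - q t) * v \<le> u"
      unfolding u_def v_def q_def by (rule survival_upper_bound[OF law \<mu> ab t])
    have v0: "0 \<le> v" unfolding v_def by (rule gamma_cdf_nonneg[OF \<mu>])
    have q01: "0 \<le> q t" "q t \<le> 1"
      using law by (auto simp: q_def bessel_law_def intro: prob_space.prob_le_1)
    have u: "u \<le> k a * t powr (- \<mu>)"
      unfolding u_def using gamma_cdf_bounds(1)[OF \<mu>, of "a\<^sup>2 / (2 * t)"] W[of a t] ab t by (simp add: m_def)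
    have v: "v \<le> k b * t powr (- \<mu>)" "(1 - b\<^sup>2 / (2 * t)) * (k b * t powr (- \<mu>)) \<le> v"
      unfolding v_def using gamma_cdf_bounds[OF \<mu>, of "b\<^sup>2 / (2 * t)"] W[of b t] ab t
      by (simp_all add: m_def flip: times_divide_eq_right)
    have "0 \<le> (1 - q t) * v" using q01 v0 by simp
    thus crude: "q t \<le> k a * t powr (- \<mu>)" using main u by linarith
    have "q t * v \<le> (k a * t powr (- \<mu>)) * (k b * t powr (- \<mu>))"
      using crude v(1) q01 v0 k by (intro mult_mono) auto
    also have "\<dots> = k a * k b * t powr (- 2 * \<mu>)"
      using powr_add[of t "- \<mu>" "- \<mu>"] by (simp add: algebra_simps)
    finally have qv: "q t * v \<le> k a * k b * t powr (- 2 * \<mu>)" .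
    have "q t \<le> u - v + q t * v" using main by (simp add: algebra_simps)
    also have "\<dots> \<le> k a * t powr (- \<mu>) - (1 - b\<^sup>2 / (2 * t)) * (k b * t powr (- \<mu>)) + k a * k b * t powr (- 2 * \<mu>)"
      using u v(2) qv by linarith
    also have "k a * t powr (- \<mu>) - (1 - b\<^sup>2 / (2 * t)) * (k b * t powr (- \<mu>))
        = (k a - k b) * t powr (- \<mu>) + b\<^sup>2 / 2 * k b * (t powr (- \<mu>) / t)"
      using t by (simp add: algebra_simps)
    also have "(k a - k b) * t powr (- \<mu>) = A t" using kb A_eq[OF t] by simp
    also have "t powr (- \<mu>) / t = t powr (- \<mu> - 1)" using t by (simp add: powr_diff)
    finally show "q t - A t \<le> b\<^sup>2 / 2 * k b * t powr (- \<mu> - 1) + k a * k b * t powr (- 2 * \<mu>)" by simp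
  qed
  have lower: "A t - q t \<le> k a * (a\<^sup>2 / 2) * t powr (- \<mu> - 1)
      + (k a * \<mu> + C * (1 + k a * 2 powr \<mu> + k a * 2 powr \<mu> / \<mu>)) * t powr (- \<mu> - \<mu> / (1 + \<mu>))"
    if t: "1 \<le> t" "a\<^sup>2 \<le> t" for t
  proof -
    define \<theta> where "\<theta> = 1 / (1 + \<mu>)"
    have \<theta>: "\<theta> - 1 = - (\<mu> / (1 + \<mu>))" "\<theta> * \<mu> = \<mu> / (1 + \<mu>)"
      using \<mu> by (simp_all add: \<theta>_def field_simps)
    \<comment> \<open>The shift \<open>s = t\<^bsup>\<theta>\<^esup>\<close> balances the error terms of orders \<open>s t\<^bsup>-\<mu>-1\<^esup>\<close> and \<open>s\<^bsup>-\<mu>\<^esup> t\<^bsup>-\<mu>\<^esup>\<close>.\<close>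
    define s where "s = t powr \<theta>"
    have pos: "0 < t" "0 < s" using t by (auto simp: s_def)
    have s_t: "s * t powr (- \<mu> - 1) = t powr (- \<mu> - \<mu> / (1 + \<mu>))"
      unfolding s_def powr_add[symmetric] using \<theta>(1)
      by (intro arg_cong[where f = "\<lambda>e. t powr e"]) linarith
    have s_t': "s powr (- \<mu>) * t powr (- \<mu>) = t powr (- \<mu> - \<mu> / (1 + \<mu>))"
      unfolding s_def powr_powr powr_add[symmetric] using \<theta>(2)
      by (intro arg_cong[where f = "\<lambda>e. t powr e"]) simp
    define z where "z = a\<^sup>2 / (2 * (t + s))"
    \<comment> \<open>The last inequality is where \<open>a\<^sup>2 \<le> t\<close> enters; it keeps
      the factor \<open>1 - a\<^sup>2 / (2 * t)\<close> nonnegative in the products below.\<close>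
    have z: "0 \<le> z" "z \<le> a\<^sup>2 / (2 * t)" "a\<^sup>2 / (2 * t) \<le> 1"
      unfolding z_def using pos t by (auto intro!: frac_le)
    \<comment> \<open>Bernoulli's inequality for the exponent -\<mu>. The clock \<open>t + s\<close>
      in place of \<open>t\<close> costs a relative error \<open>\<mu> * (s / t)\<close>, which has
      the same order as the drift terms.\<close>
    have bern: "t powr (- \<mu>) * (1 - \<mu> * (s / t)) \<le> (t + s) powr (- \<mu>)"
    proof -
      have "1 - \<mu> * (s / t) \<le> 1 - \<mu> * ln (1 + s / t)"
        using mult_left_mono[OF ln_add_one_self_le_self[of "s / t"], of \<mu>] pos \<mu> by simp
      also have "\<dots> \<le> exp (- \<mu> * ln (1 + s / t))"
        using exp_ge_add_one_self[of "- \<mu> * ln (1 + s / t)"] by simp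
      also have "\<dots> = (1 + s / t) powr (- \<mu>)"
        using pos by (simp add: powr_def add_pos_pos less_imp_neq[symmetric])
      finally have "t powr (- \<mu>) * (1 - \<mu> * (s / t)) \<le> t powr (- \<mu>) * (1 + s / t) powr (- \<mu>)"
        by (rule mult_left_mono) simp
      also have "\<dots> = (t * (1 + s / t)) powr (- \<mu>)"
        using pos by (simp add: powr_mult)
      also have "t * (1 + s / t) = t + s" using pos by (simp add: field_simps)
      finally show ?thesis .
    qed
    have "(1 - a\<^sup>2 / (2 * t)) * (1 - \<mu> * (s / t)) \<ge> 1 - a\<^sup>2 / (2 * t) - \<mu> * (s / t)"
    proof -
      have "0 \<le> a\<^sup>2 / (2 * t) * (\<mu> * (s / t))" using pos \<mu> by simp
      thus ?thesis by (simp only: left_diff_distrib right_diff_distrib mult_1 mult_1_right)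
    qed
    hence "k a * t powr (- \<mu>) * (1 - a\<^sup>2 / (2 * t) - \<mu> * (s / t))
        \<le> k a * t powr (- \<mu>) * ((1 - a\<^sup>2 / (2 * t)) * (1 - \<mu> * (s / t)))"
      using k by (intro mult_left_mono) auto
    also have "\<dots> = (1 - a\<^sup>2 / (2 * t)) * (k a * (t powr (- \<mu>) * (1 - \<mu> * (s / t))))"
      by (simp only: mult_ac)
    also have "\<dots> \<le> (1 - a\<^sup>2 / (2 * t)) * (k a * (t + s) powr (- \<mu>))"
      using bern k z by (intro mult_left_mono) auto
    also have "\<dots> \<le> (1 - z) * (k a * (t + s) powr (- \<mu>))"
      using z k by (intro mult_right_mono) auto
    also have "\<dots> \<le> gamma_cdf \<mu> z"
      using gamma_cdf_bounds(2)[OF \<mu> z(1)] W[of a "t + s"] ab pos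
      by (simp add: z_def m_def flip: times_divide_eq_right)
    finally have "F * (k a * t powr (- \<mu>) * (1 - a\<^sup>2 / (2 * t) - \<mu> * (s / t))) \<le> F * gamma_cdf \<mu> z"
      using F by (intro mult_left_mono) auto
    moreover have "F * (k a * t powr (- \<mu>) * (1 - a\<^sup>2 / (2 * t) - \<mu> * (s / t)))
        = A t - F * (k a * t powr (- \<mu>) * (a\<^sup>2 / (2 * t) + \<mu> * (s / t)))"
      using A_eq[OF pos(1)] by (simp add: algebra_simps)
    moreover have "F * (k a * t powr (- \<mu>) * (a\<^sup>2 / (2 * t) + \<mu> * (s / t)))
        \<le> 1 * (k a * t powr (- \<mu>) * (a\<^sup>2 / (2 * t) + \<mu> * (s / t)))"
      using F k pos \<mu> by (intro mult_right_mono) auto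
    moreover have "1 * (k a * t powr (- \<mu>) * (a\<^sup>2 / (2 * t) + \<mu> * (s / t)))
        = k a * (a\<^sup>2 / 2) * t powr (- \<mu> - 1) + k a * \<mu> * (s * t powr (- \<mu> - 1))"
      using pos by (simp add: powr_diff field_simps)
    moreover have "F * gamma_cdf \<mu> z
      \<le> q t + C * (s * t powr (- \<mu> - 1) + q s * (t / 2) powr (- \<mu>) + q (t / 2) * (s powr (- \<mu>) / \<mu>))"
      using survival_lower_bound[OF law \<mu> ab pos]
      by (simp only: F_def z_def q_def C_def mult.commute)
    moreover have "C * (s * t powr (- \<mu> - 1) + q s * (t / 2) powr (- \<mu>) + q (t / 2) * (s powr (- \<mu>) / \<mu>))
      \<le> C * (t powr (- \<mu> - \<mu> / (1 + \<mu>)) + k a * 2 powr \<mu> * t powr (- \<mu> - \<mu> / (1 + \<mu>))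
          + k a * 2 powr \<mu> / \<mu> * t powr (- \<mu> - \<mu> / (1 + \<mu>)))"
    proof (intro mult_left_mono[OF _ C] add_mono)
      have half: "(t / 2) powr (- \<mu>) = 2 powr \<mu> * t powr (- \<mu>)"
        using pos by (simp add: powr_divide powr_minus_divide)
      have "q s * (t / 2) powr (- \<mu>) \<le> k a * s powr (- \<mu>) * (t / 2) powr (- \<mu>)"
        using crude[OF pos(2)] by (intro mult_right_mono) auto
      thus "q s * (t / 2) powr (- \<mu>) \<le> k a * 2 powr \<mu> * t powr (- \<mu> - \<mu> / (1 + \<mu>))"
        by (simp add: half mult_ac flip: s_t')
      have "q (t / 2) * (s powr (- \<mu>) / \<mu>) \<le> k a * (t / 2) powr (- \<mu>) * (s powr (- \<mu>) / \<mu>)"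
        using crude[of "t / 2"] pos \<mu> by (intro mult_right_mono) auto
      thus "q (t / 2) * (s powr (- \<mu>) / \<mu>) \<le> k a * 2 powr \<mu> / \<mu> * t powr (- \<mu> - \<mu> / (1 + \<mu>))"
        by (simp add: half mult_ac flip: s_t')
    qed (simp add: s_t)
    ultimately have "A t - q t \<le> k a * (a\<^sup>2 / 2) * t powr (- \<mu> - 1) + k a * \<mu> * t powr (- \<mu> - \<mu> / (1 + \<mu>))
        + C * (t powr (- \<mu> - \<mu> / (1 + \<mu>)) + k a * 2 powr \<mu> * t powr (- \<mu> - \<mu> / (1 + \<mu>))
          + k a * 2 powr \<mu> / \<mu> * t powr (- \<mu> - \<mu> / (1 + \<mu>)))"
      unfolding s_t by linarith
    thus ?thesis by (simp add: distrib_left distrib_right mult.assoc)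
  qed
  show thesis
  proof (rule that)
    show "0 \<le> b\<^sup>2 / 2 * k b + k a * (a\<^sup>2 / 2)" "0 \<le> k a * k b"
      "0 \<le> k a * \<mu> + C * (1 + k a * 2 powr \<mu> + k a * 2 powr \<mu> / \<mu>)"
      using k[of a] k[of b] C \<mu> by auto
    fix t :: real assume t: "1 \<le> t" "a\<^sup>2 \<le> t"
    have "0 \<le> b\<^sup>2 / 2 * k b * t powr (- \<mu> - 1)" "0 \<le> k a * (a\<^sup>2 / 2) * t powr (- \<mu> - 1)"
      "0 \<le> k a * k b * t powr (- 2 * \<mu>)"
      "0 \<le> (k a * \<mu> + C * (1 + k a * 2 powr \<mu> + k a * 2 powr \<mu> / \<mu>)) * t powr (- \<mu> - \<mu> / (1 + \<mu>))"
      using k[of a] k[of b] C \<mu> by auto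
    with fine[of t] lower[OF t] t
    show "\<bar>q t - A t\<bar> \<le> (b\<^sup>2 / 2 * k b + k a * (a\<^sup>2 / 2)) * t powr (- \<mu> - 1) + k a * k b * t powr (- 2 * \<mu>)
       + (k a * \<mu> + C * (1 + k a * 2 powr \<mu> + k a * 2 powr \<mu> / \<mu>)) * t powr (- \<mu> - \<mu> / (1 + \<mu>))"
      unfolding distrib_right[of "b\<^sup>2 / 2 * k b"] by linarith
  qed
qed

theorem theorem2:
  fixes \<nu> a b \<epsilon> :: real and P :: "(real \<Rightarrow> real) measure"
  assumes "\<nu> < 0" and "0 < b" and "b < a"
    and "bessel_law \<nu> a P"
    and "0 < \<epsilon>" and "\<epsilon> < \<bar>\<nu>\<bar> / (1 + \<bar>\<nu>\<bar>)"
  shows "(\<lambda>t. \<P>(w in P. hitting_time b w > ereal t)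
            - a powr (2 * \<bar>\<nu>\<bar>) * (1 - (b / a) powr (2 * \<bar>\<nu>\<bar>))
                * (1 / (Gamma (1 + \<bar>\<nu>\<bar>) * (2 * t) powr \<bar>\<nu>\<bar>)))
         \<in> O[at_top](\<lambda>t. t powr (- \<bar>\<nu>\<bar> - \<epsilon>))"
proof -
  define \<mu> where "\<mu> = \<bar>\<nu>\<bar>"
  have \<mu>: "0 < \<mu>" "\<nu> = - \<mu>" using assms(1) by (auto simp: \<mu>_def)
  \<comment> \<open>Since \<mu> / (1 + \<mu>) is at most \<mu> and at most 1, the third error term
    is the slowest to decay; this is the origin of the admissible range of \<epsilon>.\<close>
  have \<epsilon>: "\<epsilon> < \<mu> / (1 + \<mu>)" using assms(6) by (simp add: \<mu>_def)
  also have "\<mu> / (1 + \<mu>) \<le> \<mu>" using \<mu> by (simp add: field_simps)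
  finally have \<epsilon>_\<mu>: "\<epsilon> < \<mu>" .
  have "\<mu> / (1 + \<mu>) \<le> 1" using \<mu> by (simp add: field_simps)
  hence \<epsilon>_1: "\<epsilon> < 1" using \<epsilon> by simp
  have law: "bessel_law (- \<mu>) a P" using assms(4) \<mu>(2) by simp
  obtain D1 D2 D3 where D: "\<And>t. 1 \<le> t \<Longrightarrow> a\<^sup>2 \<le> t \<Longrightarrow>
    \<bar>\<P>(w in P. hitting_time b w > ereal t)
      - a powr (2 * \<mu>) * (1 - (b / a) powr (2 * \<mu>)) * (1 / (Gamma (1 + \<mu>) * (2 * t) powr \<mu>))\<bar>
    \<le> D1 * t powr (- \<mu> - 1) + D2 * t powr (- 2 * \<mu>) + D3 * t powr (- \<mu> - \<mu> / (1 + \<mu>))"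
    "0 \<le> D1" "0 \<le> D2" "0 \<le> D3"
    by (rule survival_asymptotics[OF law \<mu>(1) assms(2,3)]) blast
  show ?thesis
    unfolding \<mu>_def[symmetric]
  proof (rule bigoI)
    show "\<forall>\<^sub>F t in at_top. norm (\<P>(w in P. hitting_time b w > ereal t)
            - a powr (2 * \<mu>) * (1 - (b / a) powr (2 * \<mu>)) * (1 / (Gamma (1 + \<mu>) * (2 * t) powr \<mu>)))
         \<le> (D1 + D2 + D3) * norm (t powr (- \<mu> - \<epsilon>))"
      using eventually_ge_at_top[of 1] eventually_ge_at_top[of "a\<^sup>2"]
    proof eventually_elim
      case (elim t)
      have "D1 * t powr (- \<mu> - 1) + D2 * t powr (- 2 * \<mu>) + D3 * t powr (- \<mu> - \<mu> / (1 + \<mu>))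
          \<le> D1 * t powr (- \<mu> - \<epsilon>) + D2 * t powr (- \<mu> - \<epsilon>) + D3 * t powr (- \<mu> - \<epsilon>)"
        using elim \<epsilon> \<epsilon>_\<mu> \<epsilon>_1 D(2-4) by (intro add_mono mult_left_mono powr_mono) auto
      thus ?case using D(1)[OF elim] by (simp add: distrib_right)
    qed
  qed
qed

end
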